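(* Let $T$ be a finite plane tree. For any $\epsilon>0$ there are constants $c>0$ and $n_0$ such that for all $n\ge n_0$ \[ \mathbb{P}\left( \left| \frac{ N_T(\mathsf{T}_n^\Omega)}{n\,\mathbb{P}(\xi \in \Omega)^{-1}} - \mathbb{P}(\mathsf{T}= T) \right| \ge \epsilon\right) \le \exp(-cn) \] and \[ \mathbb{P}\left( \left| |\mathsf{T}_n^\Omega| - n\, \mathbb{P}(\xi \in \Omega)^{-1}\right| \ge \epsilon n \right) \le \exp(-cn). \]
   Context: Setting. $\xi$ is a random variable with values in $\mathbb{N}_0=\{0,1,2,\dots\}$ such that $\mathbb{P}(\xi=0)>0$, $\mathbb{P}(\xi\le 1)<1$, $\mathbb{E}[\xi]<1$, and there are a slowly varying function $f$ and a constant $\alpha>1$ with $\mathbb{P}(\xi=n)=f(n)n^{-1-\alpha}$ for all large enough integers $n$. $\Omega\subset\mathbb{N}_0$ is a fixed non-empty set with $\mathbb{P}(\xi\in\Omega)>0$ such that $\Omega$ or its complement $\mathbb{N}_0\setminus\Omega$ is finite. $\mathsf{T}$ is a Galton--Watson tree with offspring distribution $\xi$, regarded as a plane tree (rooted tree in which the offspring of each vertex is linearly ordered). The outdegree of a vertex is its number of children, and $|\cdot|$ denotes the number of vertices. For $n$ large enough, $\mathsf{T}_n^\Omega$ denotes $\mathsf{T}$ conditioned on having exactly $n$ vertices with outdegree in $\Omega$. The fringe subtree of a plane tree $S$ at a vertex $v$ is the subtree consisting of $v$ and all its descendants. $N_T(S)$ is the number of vertices of $S$ at which the fringe subtree equals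 $T$ (as a plane tree). *)

theory Defs
  imports "HOL-Probability.Probability"
begin

text \<open>
  Plane trees are represented by their sets of vertices in Ulam--Harris notation: the root is
  the empty list, and the children of the vertex \<open>v\<close> are \<open>v @ [0]\<close>, \<open>v @ [1]\<close>, \<open>\<dots>\<close>, in this order.
  Each locally finite plane tree is represented by exactly one such set, so equality of sets is
  equality of plane trees.
\<close>

type_synonym vertex = "nat list"

definition outdegree :: "vertex set \<Rightarrow> vertex \<Rightarrow> nat" where
  "outdegree S v = card {i. v @ [i] \<in> S}"

definition plane_tree :: "vertex set \<Rightarrow> bool" where
  "plane_tree S \<longleftrightarrow>
     [] \<in> S \<and>
     (\<forall>v i. v @ [i] \<in> S \<longrightarrow> v \<in> S) \<and>
     (\<forall>v i j. v @ [j] \<in> S \<longrightarrow> i < j \<longrightarrow> v @ [i] \<in> S) \<and>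
     (\<forall>v. finite {i. v @ [i] \<in> S})"

definition fringe_subtree :: "vertex set \<Rightarrow> vertex \<Rightarrow> vertex set" where
  "fringe_subtree S v = {w. v @ w \<in> S}"

definition fringe_count :: "vertex set \<Rightarrow> vertex set \<Rightarrow> nat" where
  "fringe_count T S = card {v \<in> S. fringe_subtree S v = T}"

definition outdegree_count :: "nat set \<Rightarrow> vertex set \<Rightarrow> nat" where
  "outdegree_count \<Omega> S = card {v \<in> S. outdegree S v \<in> \<Omega>}"

text \<open>
  The Galton--Watson tree is built from independent copies \<open>X v\<close> of the offspring variable, where
  \<open>X v\<close> is the number of children of \<open>v\<close> if \<open>v\<close> belongs to the tree. A list is a vertex iff each
  step along it goes to an existing child. The tree may be infinite, in which case the
  cardinalities above can take the junk value 0; in the subcritical case this happens with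
  probability 0.
\<close>

definition galton_watson_tree :: "(vertex \<Rightarrow> 'w \<Rightarrow> nat) \<Rightarrow> 'w \<Rightarrow> vertex set" where
  "galton_watson_tree X \<omega> = {v. \<forall>k < length v. v ! k < X (take k v) \<omega>}"

definition iid_offspring :: "'w measure \<Rightarrow> nat pmf \<Rightarrow> (vertex \<Rightarrow> 'w \<Rightarrow> nat) \<Rightarrow> bool" where
  "iid_offspring M p X \<longleftrightarrow>
     prob_space.indep_vars M (\<lambda>_. count_space UNIV) X UNIV \<and>
     (\<forall>v. distr M (count_space UNIV) (X v) = measure_pmf p)"

text \<open>
  Slow variation at infinity in the sense of Karamata; the function only matters near infinity.
\<close>

definition slowly_varying :: "(real \<Rightarrow> real) \<Rightarrow> bool" where
  "slowly_varying f \<longleftrightarrow>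
     (\<exists>a. (\<forall>x\<ge>a. f x > 0) \<and> f \<in> borel_measurable (restrict_space borel {a..})) \<and>
     (\<forall>t>0. ((\<lambda>x. f (t * x) / f x) \<longlongrightarrow> 1) at_top)"

lemma galton_watson_tree_snoc_iff:
  "v @ [i] \<in> galton_watson_tree X \<omega> \<longleftrightarrow> v \<in> galton_watson_tree X \<omega> \<and> i < X v \<omega>"
  by (auto simp: galton_watson_tree_def nth_append less_Suc_eq)

lemma plane_tree_galton_watson_tree: "plane_tree (galton_watson_tree X \<omega>)"
  by (auto simp: plane_tree_def galton_watson_tree_snoc_iff) (simp add: galton_watson_tree_def)

lemma outdegree_galton_watson_tree:
  "v \<in> galton_watson_tree X \<omega> \<Longrightarrow> outdegree (galton_watson_tree X \<omega>) v = X v \<omega>"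
  by (simp add: outdegree_def galton_watson_tree_snoc_iff)

end

theory Submission
  imports
    Defs
    "HOL-Computational_Algebra.Polynomial"
    "HOL-Real_Asymp.Real_Asymp"
begin

text \<open>
  Call a vertex marked if its outdegree lies in \<open>\<Omega>\<close>, and write \<open>\<pi>\<close> for the probability that the
  root is marked. Conditioning on exactly \<open>n\<close> marked vertices costs little: the probability of that
  event decays more slowly than any exponential. So it suffices to bound, without conditioning, the
  probability that the tree has \<open>n\<close> marked vertices and violates one of the two conclusions by
  some \<open>exp (- c * n)\<close>.

  \<^bold>\<open>Atypical trees are exponentially unlikely.\<close> A finite plane tree is determined by the sequence of
  its outdegrees in depth-first order, and the Galton--Watson tree equals a given tree \<open>t\<close> with the
  probability that a sequence of \<open>|t|\<close> independent offspring numbers equals that word. Hence the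
  Galton--Watson tree has size \<open>m\<close> and a word in some set with at most the probability that an
  independent word of length \<open>m\<close> lies in this set (\<open>prob_tree_event_le_word\<close>). The number of marked
  vertices is a letter count. Depth-first words are prefix-free, so the number of fringe copies of
  \<open>T\<close> is the number of occurrences of the word of \<open>T\<close> as a factor (\<open>fringe_count_verts\<close>). Both are
  sums of indicators of sliding windows and concentrate around \<open>m * \<pi>\<close> and \<open>m * P(GW = T)\<close> by
  Hoeffding's inequality (\<open>window_concentration\<close>). In a word for which both are typical,
  having \<open>n\<close> marks forces the length to be close to \<open>n / \<pi>\<close> and then the fringe count to be
  close to \<open>n / \<pi> * P(GW = T)\<close>. A tree with \<open>n\<close> marked vertices has size at least
  \<open>n\<close>, so the bounds for the atypical words form a geometric series with sum of order
  \<open>exp (- c * n)\<close> (\<open>prob_large_bad_tree_le\<close>).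

  \<^bold>\<open>The condition is not exponentially unlikely.\<close> The strategy is one big jump: a root of degree
  proportional to \<open>n\<close> whose children carry small trees. Slow variation makes the cost of the degree
  polynomial (\<open>slowly_varying_lower_bound\<close>). Because the tree is almost surely
  finite, some finite set of trees has total probability close to 1; the coefficients of the powers of
  its generating polynomial are the probabilities of forests with a given number of marks. Some
  block of trees with a suitable number of marks is cheap by a pigeonhole argument
  (\<open>exists_large_coeff_power\<close>). Repeating this block and adding a bounded number of trees with a
  single mark each reaches every large \<open>n\<close> exactly
  (\<open>prob_outdegree_count_subexponential\<close>).
\<close>

section \<open>Finite plane trees and their depth-first words\<close>

text \<open>
  Finite plane trees as an inductive type, so that their properties can be proved by
  induction. Every finite plane tree in Ulam--Harris notation is \<open>verts t\<close> for exactly one such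
  \<open>t\<close> (\<open>finite_plane_tree_is_verts\<close>, \<open>inj_verts\<close>).
\<close>

datatype ptree = Node (children: "ptree list")

fun has_vertex :: "ptree \<Rightarrow> vertex \<Rightarrow> bool" where
  "has_vertex t [] = True"
| "has_vertex t (i # v) = (i < length (children t) \<and> has_vertex (children t ! i) v)"

definition verts :: "ptree \<Rightarrow> vertex set" where
  "verts t = {v. has_vertex t v}"

lemma verts_Nil [simp]: "[] \<in> verts t"
  by (simp add: verts_def)

lemma verts_Cons [simp]:
  "i # v \<in> verts t \<longleftrightarrow> i < length (children t) \<and> v \<in> verts (children t ! i)"
  by (simp add: verts_def)

lemma verts_unfold:
  "verts t = insert [] (\<Union>i<length (children t). (#) i ` verts (children t ! i))"
proof (rule set_eqI)
  fix v show "v \<in> verts t \<longleftrightarrow> v \<in> insert [] (\<Union>i<length (children t). (#) i ` verts (children t ! i))"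
    by (cases v) auto
qed

lemma finite_verts [simp]: "finite (verts t)"
proof (induction t)
  case (Node ts)
  then show ?case by (subst verts_unfold) auto
qed

lemma verts_snoc_iff:
  "v @ [i] \<in> verts t \<longleftrightarrow> v \<in> verts t \<and> i < outdegree (verts t) v"
proof (induction v arbitrary: t)
  case Nil
  have "{j. j < length (children t)} = {..<length (children t)}" by auto
  then show ?case by (simp add: outdegree_def)
next
  case (Cons j v)
  have "outdegree (verts t) (j # v) = outdegree (verts (children t ! j)) v"
    if "j < length (children t)"
    using that by (simp add: outdegree_def)
  then show ?case by (cases "j < length (children t)") (simp_all add: Cons.IH)
qed

lemma fringe_subtree_Nil [simp]: "fringe_subtree S [] = S"
  by (simp add: fringe_subtree_def)

lemma fringe_subtree_Cons [simp]:
  "i < length (children t) \<Longrightarrow>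
     fringe_subtree (verts t) (i # v) = fringe_subtree (verts (children t ! i)) v"
  by (simp add: fringe_subtree_def)

lemma plane_tree_iff_outdegree:
  assumes "plane_tree S"
  shows "v @ [i] \<in> S \<longleftrightarrow> i < outdegree S v"
proof -
  define D where "D = {i. v @ [i] \<in> S}"
  have "finite D" and down: "\<And>i j. j \<in> D \<Longrightarrow> i < j \<Longrightarrow> i \<in> D"
    using assms unfolding plane_tree_def D_def by blast+
  have "D = {..<card D}"
  proof (cases "D = {}")
    case False
    have "D = {..Max D}"
      using Max_in[OF \<open>finite D\<close> False] Max_ge[OF \<open>finite D\<close>] down by (auto simp: le_less)
    then show ?thesis by (metis card_atMost lessThan_Suc_atMost)
  qed auto
  then show ?thesis unfolding outdegree_def D_def by auto
qed

lemma plane_tree_fringe_subtree: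
  assumes "plane_tree S" "v \<in> S"
  shows "plane_tree (fringe_subtree S v)"
proof -
  have "(v @ u) @ [i] \<in> S \<Longrightarrow> v @ u \<in> S"
    "(v @ u) @ [j] \<in> S \<Longrightarrow> i < j \<Longrightarrow> (v @ u) @ [i] \<in> S"
    "finite {i. (v @ u) @ [i] \<in> S}" for u i j
    using assms(1) unfolding plane_tree_def by blast+
  with assms(2) show ?thesis
    unfolding plane_tree_def fringe_subtree_def by (simp del: append_assoc add: append_assoc[symmetric])
qed

lemma finite_plane_tree_is_verts:
  assumes "finite S" "plane_tree S"
  shows "\<exists>t. verts t = S"
  using assms
proof (induction "card S" arbitrary: S rule: less_induct)
  case less
  define k where "k = outdegree S []"
  have root: "[i] \<in> S \<longleftrightarrow> i < k" for i
    using plane_tree_iff_outdegree[OF less.prems(2), of "[]" i] by (simp add: k_def)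
  have prefix: "u \<in> S" if "u @ v \<in> S" for u v
    using that
  proof (induction v rule: rev_induct)
    case (snoc i v)
    then show ?case using less.prems(2) unfolding plane_tree_def
      by (metis append.assoc)
  qed simp
  have "\<exists>t. verts t = fringe_subtree S [i]" if "i < k" for i
  proof (rule less.hyps)
    let ?F = "fringe_subtree S [i]"
    have sub: "(#) i ` ?F \<subseteq> S - {[]}" by (auto simp: fringe_subtree_def)
    have fin: "finite ?F"
      using finite_subset[OF sub] less.prems(1) by (auto dest: finite_imageD)
    have "card ?F = card ((#) i ` ?F)" by (simp add: card_image)
    also have "\<dots> \<le> card (S - {[]})" by (intro card_mono sub) (use less.prems in auto)
    also have "\<dots> < card S"
      using less.prems by (intro psubset_card_mono) (auto simp: plane_tree_def)
    finally show "card ?F < card S" .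
    show "finite ?F" by (fact fin)
    show "plane_tree ?F" using less.prems root that by (intro plane_tree_fringe_subtree) auto
  qed
  then obtain g where g: "\<And>i. i < k \<Longrightarrow> verts (g i) = fringe_subtree S [i]" by metis
  have "v \<in> verts (Node (map g [0..<k])) \<longleftrightarrow> v \<in> S" for v
  proof (cases v)
    case Nil
    then show ?thesis using less.prems by (simp add: plane_tree_def)
  next
    case (Cons i u)
    have "i < k" if "i # u \<in> S" using prefix[of "[i]" u] that root by simp
    then show ?thesis using Cons by (auto simp: g fringe_subtree_def)
  qed
  then show ?case by blast
qed

text \<open>
  All fringe subtrees, with multiplicity, in depth-first order of their roots. Every vertex
  statistic used below is a function of the fringe subtree at the vertex, hence can be read off
  from this list.
\<close>

fun fringe_trees :: "ptree \<Rightarrow> ptree list" where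
  "fringe_trees (Node ts) = Node ts # concat (map fringe_trees ts)"

definition dfs_word :: "ptree \<Rightarrow> nat list" where
  "dfs_word t = map (\<lambda>s. length (children s)) (fringe_trees t)"

lemma dfs_word_Node: "dfs_word (Node ts) = length ts # concat (map dfs_word ts)"
  by (simp add: dfs_word_def[abs_def] map_concat comp_def)

text \<open>
  Formulated as a sum of singleton multisets, the identity follows by splitting the vertex set
  into the root and the disjoint branches.
\<close>

lemma sum_fringe_subtrees:
  "(\<Sum>v\<in>verts t. {#fringe_subtree (verts t) v#}) = mset (map verts (fringe_trees t))"
proof (induction t)
  case (Node ts)
  let ?F = "\<lambda>v. {#fringe_subtree (verts (Node ts)) v#}"
  let ?U = "\<Union>i<length ts. (#) i ` verts (ts ! i)"
  have "(\<Sum>v\<in>verts (Node ts). ?F v) = (\<Sum>v\<in>insert [] ?U. ?F v)"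
    by (subst verts_unfold) simp
  also have "\<dots> = ?F [] + (\<Sum>v\<in>?U. ?F v)" by (subst sum.insert) auto
  also have "(\<Sum>v\<in>?U. ?F v) = (\<Sum>i<length ts. \<Sum>v\<in>(#) i ` verts (ts ! i). ?F v)"
    by (intro sum.UNION_disjoint) auto
  also have "\<dots> = (\<Sum>i<length ts. \<Sum>v\<in>verts (ts ! i). {#fringe_subtree (verts (ts ! i)) v#})"
    by (intro sum.cong[OF refl]) (simp add: sum.reindex)
  also have "\<dots> = (\<Sum>i<length ts. mset (map verts (fringe_trees (ts ! i))))"
    by (intro sum.cong refl Node) auto
  also have "\<dots> = (\<Sum>t\<leftarrow>ts. mset (map verts (fringe_trees t)))"
    by (simp add: sum_list_sum_nth lessThan_atLeast0)
  also have "\<dots> = mset (map verts (concat (map fringe_trees ts)))"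
    by (induction ts) auto
  finally show ?case by simp
qed

lemma image_mset_fringe_subtree:
  "image_mset (fringe_subtree (verts t)) (mset_set (verts t)) = mset (map verts (fringe_trees t))"
proof -
  have "image_mset h (mset_set A) = (\<Sum>v\<in>A. {#h v#})" if "finite A" for h :: "vertex \<Rightarrow> vertex set" and A
    using that by (induction A rule: finite_induct) auto
  then show ?thesis using sum_fringe_subtrees by simp
qed

lemma card_fringe_subtrees:
  "card {v \<in> verts t. Q (fringe_subtree (verts t) v)} = length (filter (\<lambda>s. Q (verts s)) (fringe_trees t))"
proof -
  have "card {v \<in> verts t. Q (fringe_subtree (verts t) v)}
      = size (filter_mset Q (image_mset (fringe_subtree (verts t)) (mset_set (verts t))))"
    by (simp add: filter_mset_image_mset Collect_conj_eq Int_commute flip: size_mset_set)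
  also have "\<dots> = size (mset (filter Q (map verts (fringe_trees t))))"
    by (simp only: image_mset_fringe_subtree mset_filter)
  also have "\<dots> = length (filter (\<lambda>s. Q (verts s)) (fringe_trees t))"
    by (simp only: size_mset filter_map length_map comp_def)
  finally show ?thesis .
qed

lemma outdegree_fringe_subtree: "outdegree S v = outdegree (fringe_subtree S v) []"
  by (simp add: outdegree_def fringe_subtree_def)

lemma outdegree_root [simp]: "outdegree (verts t) [] = length (children t)"
  by (simp add: outdegree_def)

lemma outdegree_count_verts: "outdegree_count \<Omega> (verts t) = length (filter (\<lambda>k. k \<in> \<Omega>) (dfs_word t))"
  unfolding outdegree_count_def outdegree_fringe_subtree[of "verts t"]
    card_fringe_subtrees[of t "\<lambda>S. outdegree S [] \<in> \<Omega>"]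
  by (simp add: dfs_word_def filter_map comp_def)

lemma card_verts: "card (verts t) = length (dfs_word t)"
  using card_fringe_subtrees[of t "\<lambda>_. True"] by (simp add: dfs_word_def)

lemma prod_outdegree_verts:
  fixes g :: "nat \<Rightarrow> real"
  shows "(\<Prod>v\<in>verts t. g (outdegree (verts t) v)) = prod_list (map g (dfs_word t))"
proof -
  have "(\<Prod>v\<in>verts t. g (outdegree (verts t) v))
      = prod_mset (image_mset (\<lambda>S. g (outdegree S []))
          (image_mset (fringe_subtree (verts t)) (mset_set (verts t))))"
    unfolding outdegree_fringe_subtree[of "verts t"]
    by (simp add: prod_unfold_prod_mset multiset.map_comp comp_def)
  also have "\<dots> = prod_list (map g (dfs_word t))"
    unfolding image_mset_fringe_subtree
    by (simp add: dfs_word_def comp_def multiset.map_comp flip: prod_mset_prod_list)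
  finally show ?thesis .
qed

text \<open>
  Reading a depth-first word from the left one knows how many subtrees are still to come, so
  one can see where the word of a tree ends.
\<close>

lemma dfs_word_prefix_free:
  "dfs_word s @ xs = dfs_word t @ ys \<Longrightarrow> s = t \<and> xs = ys"
proof (induction s arbitrary: t xs ys)
  case (Node ss)
  obtain ts where t: "t = Node ts" by (cases t)
  have len: "length ss = length ts"
    and eq: "concat (map dfs_word ss) @ xs = concat (map dfs_word ts) @ ys"
    using Node.prems by (simp_all add: t dfs_word_Node)
  from len eq Node.IH have "ss = ts \<and> xs = ys"
  proof (induction ss ts rule: list_induct2)
    case (Cons s ss t ts)
    have "s = t \<and> concat (map dfs_word ss) @ xs = concat (map dfs_word ts) @ ys"
      by (rule Cons.prems(2)) (use Cons.prems(1) in auto)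
    then show ?case using Cons.IH Cons.prems(2) by auto
  qed auto
  then show ?case by (simp add: t)
qed

lemma inj_dfs_word: "inj dfs_word"
  using dfs_word_prefix_free[of _ "[]" _ "[]"] by (auto intro: injI)

lemma inj_verts: "inj verts"
proof (rule injI)
  fix s t assume "verts s = verts t"
  then show "s = t"
  proof (induction s arbitrary: t)
    case (Node ss)
    obtain ts where t: "t = Node ts" by (cases t)
    have len: "length ss = length ts"
      using arg_cong[OF Node.prems, of "\<lambda>S. outdegree S []"] by (simp add: t)
    have "ss ! i = ts ! i" if "i < length ss" for i
    proof (rule Node.IH)
      show "verts (ss ! i) = verts (ts ! i)"
        using arg_cong[OF Node.prems, of "\<lambda>S. fringe_subtree S [i]"] that len by (simp add: t)
    qed (use that in auto)
    then show ?case using len by (simp add: t nth_equalityI)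
  qed
qed

fun occurrences :: "'b list \<Rightarrow> 'b list \<Rightarrow> nat" where
  "occurrences w [] = 0"
| "occurrences w (x # xs) = (if take (length w) (x # xs) = w then 1 else 0) + occurrences w xs"

text \<open>
  The suffix of a depth-first word that starts at a vertex begins with the word of the fringe
  subtree at this vertex. By prefix-freeness no other tree's word can be a prefix of it. The trailing
  \<open>ys\<close> is needed for the induction over the branches.
\<close>

lemma occurrences_dfs_word:
  "occurrences (dfs_word s) (dfs_word t @ ys)
     = length (filter (\<lambda>u. u = s) (fringe_trees t)) + occurrences (dfs_word s) ys"
proof (induction t arbitrary: ys)
  case (Node ts)
  have match: "take (length (dfs_word s)) (dfs_word (Node ts) @ ys) = dfs_word s \<longleftrightarrow> Node ts = s"
    using dfs_word_prefix_free[of s "drop (length (dfs_word s)) (dfs_word (Node ts) @ ys)" "Node ts" ys]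
    by (metis append_eq_conv_conj append_take_drop_id)
  have forest: "occurrences (dfs_word s) (concat (map dfs_word us) @ ys)
      = length (filter (\<lambda>u. u = s) (concat (map fringe_trees us))) + occurrences (dfs_word s) ys"
    if "set us \<subseteq> set ts" for us
    using that by (induction us) (auto simp: Node.IH)
  show ?case using match forest[of ts] by (auto simp: dfs_word_Node)
qed

lemma fringe_count_verts:
  "fringe_count (verts s) (verts t) = occurrences (dfs_word s) (dfs_word t)"
  using occurrences_dfs_word[of s t "[]"]
  unfolding fringe_count_def card_fringe_subtrees[of t "\<lambda>S. S = verts s"]
  by (simp add: inj_eq[OF inj_verts])

lemma occurrences_eq_sum:
  "occurrences w xs = (\<Sum>i<length xs. if take (length w) (drop i xs) = w then 1 else 0)"
  by (induction xs) (auto simp: sum.lessThan_Suc_shift simp del: sum.lessThan_Suc)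

instance ptree :: countable
  by countable_datatype

section \<open>The law of the Galton--Watson tree\<close>

text \<open>
  Used for the expected size of a generation and, with monomials as values, for the
  generating polynomial of a forest.
\<close>

lemma sum_prod_list_power:
  fixes g :: "'a \<Rightarrow> 'b::comm_semiring_1"
  assumes "finite A"
  shows "(\<Sum>xs | set xs \<subseteq> A \<and> length xs = d. prod_list (map g xs)) = (\<Sum>a\<in>A. g a) ^ d"
proof (induction d)
  case 0
  have "{xs. set xs \<subseteq> A \<and> length xs = 0} = {[]}" by auto
  then show ?case by simp
next
  case (Suc d)
  let ?L = "\<lambda>d. {xs. set xs \<subseteq> A \<and> length xs = d}"
  have "?L (Suc d) = (\<lambda>(a, xs). a # xs) ` (A \<times> ?L d)"
    by (auto simp: image_iff length_Suc_conv)
  then have "(\<Sum>xs\<in>?L (Suc d). prod_list (map g xs)) = (\<Sum>(a, xs)\<in>A \<times> ?L d. g a * prod_list (map g xs))"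
    by (simp add: sum.reindex inj_on_def case_prod_unfold)
  also have "\<dots> = (\<Sum>a\<in>A. g a) * (\<Sum>xs\<in>?L d. prod_list (map g xs))"
    by (simp add: sum.cartesian_product[symmetric] sum_product)
  finally show ?case using Suc by simp
qed

definition weight :: "nat pmf \<Rightarrow> ptree \<Rightarrow> real" where
  "weight p t = prod_list (map (pmf p) (dfs_word t))"

lemma weight_nonneg [simp]: "weight p t \<ge> 0"
  unfolding weight_def by (intro prod_list_nonneg) auto

lemma sum_tail_prob_le_expectation:
  fixes p :: "nat pmf"
  assumes "integrable (measure_pmf p) real"
  shows "(\<Sum>i<B. measure_pmf.prob p {i<..}) \<le> measure_pmf.expectation p real"
proof -
  have "(\<Sum>i<B. measure_pmf.prob p {i<..}) = measure_pmf.expectation p (\<lambda>k. \<Sum>i<B. indicator {i<..} k)"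
    
    by (subst Bochner_Integration.integral_sum)
      (auto intro!: integrable_real_indicator simp: measure_pmf.emeasure_eq_measure)
  also have "\<dots> \<le> measure_pmf.expectation p real"
  proof (rule integral_mono_AE)
    have "(\<Sum>i<B. indicator {i<..} k) \<le> real k" for k :: nat
    proof -
      have "(\<Sum>i<B. indicator {i<..} k) = (\<Sum>i\<in>{..<B}. if i \<in> {..<k} then 1 else 0 :: real)"
        by (intro sum.cong) (auto simp: indicator_def)
      also have "\<dots> = card ({..<B} \<inter> {..<k})" by (subst sum.inter_restrict[symmetric]) auto
      also have "\<dots> \<le> card {..<k}" using card_mono[of "{..<k}" "{..<B} \<inter> {..<k}"] by auto
      finally show ?thesis by simp
    qed
    then show "AE k in measure_pmf p. (\<Sum>i<B. indicator {i<..} k) \<le> real k" by simp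
  qed (use assms in \<open>auto intro!: Bochner_Integration.integrable_sum integrable_real_indicator
      simp: measure_pmf.emeasure_eq_measure\<close>)
  finally show ?thesis .
qed

locale galton_watson = prob_space M for M :: "'w measure" +
  fixes p :: "nat pmf" and X :: "vertex \<Rightarrow> 'w \<Rightarrow> nat"
  assumes iid: "iid_offspring M p X"
begin

abbreviation "GW \<equiv> galton_watson_tree X"

lemma indep_offspring: "indep_vars (\<lambda>_. count_space UNIV) X UNIV"
  and distr_offspring: "distr M (count_space UNIV) (X v) = measure_pmf p"
  using iid by (auto simp: iid_offspring_def)

lemma measurable_offspring [measurable]: "X v \<in> measurable M (count_space UNIV)"
  using indep_offspring by (auto simp: indep_vars_def)

lemma prob_offspring: "prob {\<omega> \<in> space M. X v \<omega> \<in> A} = measure_pmf.prob p A"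
  using measure_distr[of "X v" M "count_space UNIV" A]
  by (simp add: distr_offspring vimage_def Int_def conj_commute)

lemma prob_all_offspring:
  assumes "finite F"
  shows "prob {\<omega> \<in> space M. \<forall>v\<in>F. X v \<omega> \<in> A v} = (\<Prod>v\<in>F. measure_pmf.prob p (A v))"
proof (cases "F = {}")
  case True
  then show ?thesis by (simp add: prob_space)
next
  case False
  have "{\<omega> \<in> space M. \<forall>v\<in>F. X v \<omega> \<in> A v} = (\<Inter>v\<in>F. X v -` A v \<inter> space M)"
    using False by auto
  also have "prob \<dots> = (\<Prod>v\<in>F. prob (X v -` A v \<inter> space M))"
    using indep_varsD[OF indep_offspring, of F A] assms False by simp
  also have "\<dots> = (\<Prod>v\<in>F. measure_pmf.prob p (A v))"
    by (intro prod.cong[OF refl]) (use prob_offspring in \<open>simp add: vimage_def Int_def conj_commute\<close>)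
  finally show ?thesis .
qed

lemma GW_Nil [simp]: "[] \<in> GW \<omega>"
  by (simp add: galton_watson_tree_def)

lemma GW_eq_verts_iff: "GW \<omega> = verts t \<longleftrightarrow> (\<forall>v\<in>verts t. X v \<omega> = outdegree (verts t) v)"
proof
  assume "GW \<omega> = verts t"
  then show "\<forall>v\<in>verts t. X v \<omega> = outdegree (verts t) v"
    using outdegree_galton_watson_tree[of _ X \<omega>] by simp
next
  assume deg: "\<forall>v\<in>verts t. X v \<omega> = outdegree (verts t) v"
  have "v \<in> GW \<omega> \<longleftrightarrow> v \<in> verts t" for v
  proof (induction v rule: rev_induct)
    case (snoc i v)
    then show ?case using deg by (auto simp: galton_watson_tree_snoc_iff verts_snoc_iff)
  qed simp
  then show "GW \<omega> = verts t" by blast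
qed

lemma prob_GW_eq_verts: "prob {\<omega> \<in> space M. GW \<omega> = verts t} = weight p t"
proof -
  have "prob {\<omega> \<in> space M. GW \<omega> = verts t} = (\<Prod>v\<in>verts t. pmf p (outdegree (verts t) v))"
    using prob_all_offspring[of "verts t" "\<lambda>v. {outdegree (verts t) v}"]
    by (simp add: GW_eq_verts_iff measure_pmf_single)
  then show ?thesis by (simp add: prod_outdegree_verts weight_def)
qed

lemma sets_GW_eq_verts [measurable]: "{\<omega> \<in> space M. GW \<omega> = verts t} \<in> sets M"
proof -
  have "{\<omega> \<in> space M. \<forall>v\<in>verts t. X v \<omega> = outdegree (verts t) v} \<in> sets M"
    by (rule sets.sets_Collect_finite_All) auto
  then show ?thesis by (simp add: GW_eq_verts_iff)
qed

lemma sets_mem_GW [measurable]: "{\<omega> \<in> space M. v \<in> GW \<omega>} \<in> sets M"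
  unfolding galton_watson_tree_def by simp

text \<open>
  Membership in the tree only constrains the offspring numbers of the proper ancestors, which
  are distinct vertices.
\<close>

lemma prob_mem_GW: "prob {\<omega> \<in> space M. v \<in> GW \<omega>} = prod_list (map (\<lambda>i. measure_pmf.prob p {i<..}) v)"
proof -
  define F where "F = (\<lambda>k. take k v) ` {..<length v}"
  have inj: "inj_on (\<lambda>k. take k v) {..<length v}"
    by (rule inj_onI) (metis length_take lessThan_iff min.absorb2 order_less_imp_le)
  have "{\<omega> \<in> space M. v \<in> GW \<omega>} = {\<omega> \<in> space M. \<forall>u\<in>F. X u \<omega> \<in> {v ! length u<..}}"
    unfolding galton_watson_tree_def F_def by auto
  also have "prob \<dots> = (\<Prod>u\<in>F. measure_pmf.prob p {v ! length u<..})"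
    by (rule prob_all_offspring) (simp add: F_def)
  also have "\<dots> = (\<Prod>k<length v. measure_pmf.prob p {v ! k<..})"
    unfolding F_def by (subst prod.reindex[OF inj]) (auto intro!: prod.cong)
  also have "\<dots> = prod_list (map (\<lambda>i. measure_pmf.prob p {i<..}) v)"
    by (simp add: prod.list_conv_set_nth lessThan_atLeast0)
  finally show ?thesis .
qed

text \<open>
  The expected number of vertices in generation \<open>d\<close> is at most \<open>\<mu> ^ d\<close>, where \<open>\<mu>\<close> is the mean
  of the offspring distribution.
\<close>

lemma sum_prob_mem_GW_le:
  assumes "integrable (measure_pmf p) real" "measure_pmf.expectation p real < 1" "finite F"
  shows "(\<Sum>v\<in>F. prob {\<omega> \<in> space M. v \<in> GW \<omega>}) \<le> 1 / (1 - measure_pmf.expectation p real)"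
proof -
  define \<mu> where "\<mu> = measure_pmf.expectation p real"
  have \<mu>: "0 \<le> \<mu>" "\<mu> < 1" using assms by (auto simp: \<mu>_def)
  let ?q = "\<lambda>v. prod_list (map (\<lambda>i. measure_pmf.prob p {i<..}) v)"
  obtain B where B: "\<Union>(set ` F) \<subseteq> {..<B}"
    using finite_nat_iff_bounded[of "\<Union>(set ` F)"] assms(3) by auto
  obtain K where K: "length ` F \<subseteq> {..<K}"
    using finite_nat_iff_bounded[of "length ` F"] assms(3) by auto
  let ?L = "\<lambda>d. {xs. set xs \<subseteq> {..<B} \<and> length xs = d}"
  have fin: "finite (?L d)" for d by (rule finite_lists_length_eq) simp
  have "F \<subseteq> (\<Union>d<K. ?L d)" using B K by fastforce
  then have "(\<Sum>v\<in>F. ?q v) \<le> (\<Sum>v\<in>(\<Union>d<K. ?L d). ?q v)"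
    using fin by (intro sum_mono2) (auto intro!: prod_list_nonneg)
  also have "\<dots> = (\<Sum>d<K. \<Sum>v\<in>?L d. ?q v)"
    using fin by (intro sum.UNION_disjoint) auto
  also have "\<dots> = (\<Sum>d<K. (\<Sum>i<B. measure_pmf.prob p {i<..}) ^ d)"
    by (intro sum.cong refl sum_prod_list_power) simp
  also have "\<dots> \<le> (\<Sum>d<K. \<mu> ^ d)"
    using sum_tail_prob_le_expectation[OF assms(1)] unfolding \<mu>_def
    by (intro sum_mono power_mono sum_nonneg) auto
  also have "\<dots> \<le> (\<Sum>d. \<mu> ^ d)" using \<mu> by (intro sum_le_suminf summable_geometric) auto
  also have "\<dots> = 1 / (1 - \<mu>)" using \<mu> by (intro suminf_geometric) auto
  finally show ?thesis by (simp add: prob_mem_GW \<mu>_def)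
qed

text \<open>
  Borel--Cantelli: the expected size of the tree is finite.
\<close>

lemma AE_finite_GW:
  assumes "integrable (measure_pmf p) real" "measure_pmf.expectation p real < 1"
  shows "AE \<omega> in M. finite (GW \<omega>)"
proof -
  obtain e :: "nat \<Rightarrow> vertex" where e: "bij e"
    using bij_betw_from_nat_into[of "UNIV :: vertex set"] infinite_UNIV_listI by auto
  have "summable (\<lambda>n. prob {\<omega> \<in> space M. e n \<in> GW \<omega>})"
  proof (rule summableI_nonneg_bounded)
    fix n
    have "inj_on e {..<n}" using e by (meson bij_is_inj inj_on_subset top_greatest)
    then have "(\<Sum>i<n. prob {\<omega> \<in> space M. e i \<in> GW \<omega>}) = (\<Sum>v\<in>e ` {..<n}. prob {\<omega> \<in> space M. v \<in> GW \<omega>})"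
      by (simp add: sum.reindex)
    also have "\<dots> \<le> 1 / (1 - measure_pmf.expectation p real)"
      by (intro sum_prob_mem_GW_le assms) simp
    finally show "(\<Sum>i<n. prob {\<omega> \<in> space M. e i \<in> GW \<omega>}) \<le> 1 / (1 - measure_pmf.expectation p real)" .
  qed simp
  then have "AE \<omega> in M. eventually (\<lambda>n. \<omega> \<in> space M - {\<omega> \<in> space M. e n \<in> GW \<omega>}) sequentially"
    by (intro borel_cantelli_AE1) (auto simp: emeasure_eq_measure)
  then show ?thesis
  proof eventually_elim
    case (elim \<omega>)
    then obtain N where "\<forall>n\<ge>N. e n \<notin> GW \<omega>" by (auto simp: eventually_sequentially)
    moreover have "v \<in> range e" for v using e by (metis bij_is_surj rangeI surj_def)
    ultimately have "GW \<omega> \<subseteq> e ` {..<N}" by (force simp: not_less[symmetric])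
    then show ?case by (rule finite_subset) simp
  qed
qed

end

section \<open>Comparison with words of independent letters\<close>

context galton_watson
begin

text \<open>
  The offspring numbers of the vertices \<open>[0]\<close>, \<open>[1]\<close>, \<open>\<dots>\<close> serve as a sequence of independent
  letters; this keeps all events on one probability space.
\<close>

definition word :: "nat \<Rightarrow> 'w \<Rightarrow> nat list" where
  "word m \<omega> = map (\<lambda>i. X [i] \<omega>) [0..<m]"

lemma word_eq_iff: "length w = m \<Longrightarrow> word m \<omega> = w \<longleftrightarrow> (\<forall>v\<in>(\<lambda>i. [i]) ` {..<m}. X v \<omega> = w ! hd v)"
  by (auto simp: word_def list_eq_iff_nth_eq)

lemma measurable_word [measurable]: "word m \<in> measurable M (count_space UNIV)"
proof (subst measurable_count_space_eq2_countable, safe)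
  fix w :: "nat list"
  have "{\<omega> \<in> space M. word m \<omega> = w} \<in> sets M"
  proof (cases "length w = m")
    case True
    have "{\<omega> \<in> space M. \<forall>v\<in>(\<lambda>i. [i]) ` {..<m}. X v \<omega> = w ! hd v} \<in> sets M"
      by (rule sets.sets_Collect_finite_All) auto
    then show ?thesis by (simp only: word_eq_iff[OF True])
  next
    case False
    then have "{\<omega> \<in> space M. word m \<omega> = w} = {}" by (auto simp: word_def)
    then show ?thesis by (simp only: sets.empty_sets)
  qed
  then show "word m -` {w} \<inter> space M \<in> sets M" by (simp add: vimage_def Int_def conj_commute)
qed auto

lemma prob_word_eq:
  "prob {\<omega> \<in> space M. word (length (dfs_word t)) \<omega> = dfs_word t} = weight p t"
proof -
  let ?w = "dfs_word t"
  have "prob {\<omega> \<in> space M. \<forall>v\<in>(\<lambda>i. [i]) ` {..<length ?w}. X v \<omega> \<in> {?w ! hd v}}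
      = (\<Prod>v\<in>(\<lambda>i. [i]) ` {..<length ?w}. measure_pmf.prob p {?w ! hd v})"
    by (rule prob_all_offspring) simp
  also have "\<dots> = (\<Prod>i<length ?w. pmf p (?w ! i))"
    by (subst prod.reindex) (auto simp: inj_on_def measure_pmf_single)
  also have "\<dots> = weight p t"
    by (simp add: weight_def prod.list_conv_set_nth lessThan_atLeast0)
  finally show ?thesis by (simp add: word_eq_iff)
qed

definition tree_event :: "ptree set \<Rightarrow> 'w set" where
  "tree_event A = (\<Union>t\<in>A. {\<omega> \<in> space M. GW \<omega> = verts t})"

lemma sets_tree_event [measurable]: "tree_event A \<in> sets M"
  unfolding tree_event_def by (intro sets.countable_UN') auto

lemma disjoint_GW_eq_verts: "disjoint_family_on (\<lambda>t. {\<omega> \<in> space M. GW \<omega> = verts t}) A"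
  using inj_verts by (auto simp: disjoint_family_on_def inj_def)

text \<open>
  Tree by tree, the probability of being \<open>t\<close> is that of the letters spelling the word of
  \<open>t\<close>, and distinct trees have distinct words. Summing over the trees in \<open>A\<close> gives the claim.
\<close>

lemma prob_tree_event_le_word:
  assumes "\<And>t. t \<in> A \<Longrightarrow> length (dfs_word t) = m \<and> dfs_word t \<in> B"
  shows "prob (tree_event A) \<le> prob {\<omega> \<in> space M. word m \<omega> \<in> B}"
proof -
  define D where "D = (\<lambda>t. {\<omega> \<in> space M. word m \<omega> = dfs_word t})"
  have [measurable]: "D t \<in> sets M" for t unfolding D_def by measurable
  have "emeasure M (tree_event A) = (\<integral>\<^sup>+t. emeasure M {\<omega> \<in> space M. GW \<omega> = verts t} \<partial>count_space A)"
    unfolding tree_event_def by (intro emeasure_UN_countable disjoint_GW_eq_verts) auto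
  also have "\<dots> = (\<integral>\<^sup>+t. emeasure M (D t) \<partial>count_space A)"
  proof (rule nn_integral_cong)
    fix t assume "t \<in> space (count_space A)"
    then have "m = length (dfs_word t)" using assms by simp
    then show "emeasure M {\<omega> \<in> space M. GW \<omega> = verts t} = emeasure M (D t)"
      using prob_word_eq[of t] by (simp add: emeasure_eq_measure prob_GW_eq_verts D_def)
  qed
  also have "\<dots> = emeasure M (\<Union>t\<in>A. D t)"
    by (intro emeasure_UN_countable[symmetric])
      (use inj_dfs_word in \<open>auto simp: disjoint_family_on_def D_def inj_def\<close>)
  also have "\<dots> \<le> emeasure M {\<omega> \<in> space M. word m \<omega> \<in> B}"
    by (intro emeasure_mono) (use assms in \<open>auto simp: D_def\<close>)
  finally show ?thesis by (simp add: emeasure_eq_measure)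
qed

lemma prob_tree_event_UNIV:
  assumes "integrable (measure_pmf p) real" "measure_pmf.expectation p real < 1"
  shows "prob (tree_event UNIV) = 1"
proof (subst prob_eq_1)
  show "AE \<omega> in M. \<omega> \<in> tree_event UNIV"
    using AE_finite_GW[OF assms] AE_space
  proof eventually_elim
    case (elim \<omega>)
    then show ?case
      using finite_plane_tree_is_verts[OF _ plane_tree_galton_watson_tree] unfolding tree_event_def
      by (metis (mono_tags, lifting) UN_iff UNIV_I mem_Collect_eq)
  qed
qed simp

text \<open>
  Summing the comparison with words over all sizes \<open>m \<ge> n\<close> gives a geometric series; infinite
  trees contribute nothing. No measurability of \<open>S\<close> is assumed, because the bound comes from a
  measurable superset that is a union of events \<open>GW \<omega> = verts t\<close> and a null set.
\<close>

lemma prob_large_bad_tree_le: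
  assumes "integrable (measure_pmf p) real" "measure_pmf.expectation p real < 1"
    and "c > 0"
    and bad: "\<And>m. m \<ge> n \<Longrightarrow> prob {\<omega> \<in> space M. Bad (word m \<omega>)} \<le> C * exp (- c * real m)"
    and S: "S \<subseteq> space M" "\<And>\<omega> t. \<omega> \<in> S \<Longrightarrow> GW \<omega> = verts t \<Longrightarrow> n \<le> length (dfs_word t) \<and> Bad (dfs_word t)"
  shows "prob S \<le> C / (1 - exp (- c)) * exp (- c * real n)"
proof -
  define A where "A = (\<lambda>i. {t. length (dfs_word t) = n + i \<and> Bad (dfs_word t)})"
  have le: "prob (tree_event (A i)) \<le> C * exp (- c * real n) * exp (- c) ^ i" for i
  proof -
    have "prob (tree_event (A i)) \<le> prob {\<omega> \<in> space M. word (n + i) \<omega> \<in> {w. Bad w}}"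
      by (rule prob_tree_event_le_word) (auto simp: A_def)
    also have "\<dots> \<le> C * exp (- c * real (n + i))" using bad[of "n + i"] by simp
    also have "\<dots> = C * exp (- c * real n) * exp (- c) ^ i"
      by (simp add: exp_add[symmetric] exp_of_nat_mult[symmetric] algebra_simps)
    finally show ?thesis .
  qed
  have sums: "(\<lambda>i. C * exp (- c * real n) * exp (- c) ^ i) sums (C * exp (- c * real n) * (1 / (1 - exp (- c))))"
    using \<open>c > 0\<close> by (intro sums_mult geometric_sums) simp
  have summ: "summable (\<lambda>i. prob (tree_event (A i)))"
    by (rule summable_comparison_test'[OF sums_summable[OF sums], of 0]) (use le in simp)
  have "S \<subseteq> (\<Union>i. tree_event (A i)) \<union> (space M - tree_event UNIV)"
  proof
    fix \<omega> assume "\<omega> \<in> S"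
    show "\<omega> \<in> (\<Union>i. tree_event (A i)) \<union> (space M - tree_event UNIV)"
    proof (cases "\<exists>t. GW \<omega> = verts t")
      case True
      then obtain t where t: "GW \<omega> = verts t" by blast
      then have "t \<in> A (length (dfs_word t) - n)" using S(2)[OF \<open>\<omega> \<in> S\<close> t] by (simp add: A_def)
      then show ?thesis using t \<open>\<omega> \<in> S\<close> S(1) by (auto simp: tree_event_def)
    next
      case False
      then show ?thesis using \<open>\<omega> \<in> S\<close> S(1) by (auto simp: tree_event_def)
    qed
  qed
  then have "prob S \<le> prob ((\<Union>i. tree_event (A i)) \<union> (space M - tree_event UNIV))"
    by (intro finite_measure_mono) auto
  also have "\<dots> \<le> prob (\<Union>i. tree_event (A i)) + prob (space M - tree_event UNIV)"
    by (intro measure_Un_le) auto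
  also have "prob (space M - tree_event UNIV) = 0"
    using prob_tree_event_UNIV[OF assms(1,2)] by (simp add: prob_compl)
  also have "prob (\<Union>i. tree_event (A i)) \<le> (\<Sum>i. prob (tree_event (A i)))"
    by (intro finite_measure_subadditive_countably summ) auto
  also have "\<dots> \<le> (\<Sum>i. C * exp (- c * real n) * exp (- c) ^ i)"
    by (intro suminf_le le summ sums_summable[OF sums])
  also have "\<dots> = C / (1 - exp (- c)) * exp (- c * real n)"
    using sums_unique[OF sums] by simp
  finally show ?thesis by simp
qed

text \<open>
  The indicator that the letters at positions \<open>i\<close>, \<open>\<dots>\<close>, \<open>i + l - 1\<close> match the pattern \<open>A\<close>. Patterns
  of length 1 count marks; patterns of singletons count occurrences of a word.
\<close>

definition window :: "(nat \<Rightarrow> nat set) \<Rightarrow> nat \<Rightarrow> nat \<Rightarrow> 'w \<Rightarrow> real" where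
  "window A l i \<omega> = of_bool (\<forall>k<l. X [i + k] \<omega> \<in> A k)"

lemma measurable_window [measurable]: "window A l i \<in> borel_measurable M"
  unfolding window_def by measurable

lemma expectation_window: "expectation (window A l i) = (\<Prod>k<l. measure_pmf.prob p (A k))"
proof -
  let ?E = "{\<omega> \<in> space M. \<forall>k<l. X [i + k] \<omega> \<in> A k}"
  have "expectation (window A l i) = expectation (indicator ?E)"
    by (intro Bochner_Integration.integral_cong) (auto simp: window_def indicator_def)
  also have "\<dots> = prob ?E" by (simp add: Int_absorb2 subset_iff)
  also have "\<dots> = prob {\<omega> \<in> space M. \<forall>v\<in>(\<lambda>k. [i + k]) ` {..<l}. X v \<omega> \<in> A (hd v - i)}"
    by (intro arg_cong[where f = prob]) auto
  also have "\<dots> = (\<Prod>v\<in>(\<lambda>k. [i + k]) ` {..<l}. measure_pmf.prob p (A (hd v - i)))"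
    by (rule prob_all_offspring) simp
  also have "\<dots> = (\<Prod>k<l. measure_pmf.prob p (A k))"
    by (subst prod.reindex) (auto simp: inj_on_def)
  finally show ?thesis .
qed

text \<open>
  Windows of length \<open>l\<close> whose starting points differ by multiples of \<open>l\<close> read disjoint sets of
  letters.
\<close>

lemma indep_windows:
  assumes "l > 0"
  shows "indep_vars (\<lambda>_. borel) (\<lambda>j. window A l (r + j * l)) {..<J}"
proof -
  define K where "K = (\<lambda>j. (\<lambda>k. [r + j * l + k]) ` {..<l})"
  define g where "g = (\<lambda>j (h :: vertex \<Rightarrow> nat). of_bool (\<forall>k<l. h [r + j * l + k] \<in> A k) :: real)"
  have "disjoint_family_on K {..<J}"
  proof (unfold disjoint_family_on_def, safe)
    fix a b v assume "a \<noteq> b" "v \<in> K a" "v \<in> K b"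
    then obtain k k' where "a * l + k = b * l + k'" "k < l" "k' < l" by (auto simp: K_def)
    then have "(a * l + k) div l = (b * l + k') div l" by simp
    then show "v \<in> {}" using \<open>a \<noteq> b\<close> \<open>k < l\<close> \<open>k' < l\<close> by simp
  qed
  then have "indep_vars (\<lambda>j. PiM (K j) (\<lambda>_. count_space UNIV)) (\<lambda>j \<omega>. restrict (\<lambda>v. X v \<omega>) (K j)) {..<J}"
    by (intro indep_vars_restrict[OF indep_offspring]) auto
  then have "indep_vars (\<lambda>_. borel) (\<lambda>j \<omega>. g j (restrict (\<lambda>v. X v \<omega>) (K j))) {..<J}"
  proof (rule indep_vars_compose2)
    fix j assume "j \<in> {..<J}"
    have component: "(\<lambda>h. h [r + j * l + k]) \<in> measurable (PiM (K j) (\<lambda>_. count_space UNIV)) (count_space UNIV)"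
      if "k < l" for k
      using that by (intro measurable_component_singleton) (auto simp: K_def)
    have "g j = (\<lambda>h. \<Prod>k<l. of_bool (h [r + j * l + k] \<in> A k))"
      by (auto simp: g_def fun_eq_iff of_bool_def)
    also have "\<dots> \<in> borel_measurable (PiM (K j) (\<lambda>_. count_space UNIV))"
    proof (rule borel_measurable_prod)
      fix k assume "k \<in> {..<l}"
      then show "(\<lambda>h. of_bool (h [r + j * l + k] \<in> A k) :: real)
          \<in> borel_measurable (PiM (K j) (\<lambda>_. count_space UNIV))"
        by (intro measurable_compose[OF component, where g = "\<lambda>x. of_bool (x \<in> A k)"]) auto
    qed
    finally show "g j \<in> borel_measurable (PiM (K j) (\<lambda>_. count_space UNIV))" .
  qed
  moreover have "g j (restrict (\<lambda>v. X v \<omega>) (K j)) = window A l (r + j * l) \<omega>" for j \<omega>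
    by (auto simp: g_def window_def K_def)
  ultimately show ?thesis by simp
qed

lemma spaced_window_concentration:
  assumes "l > 0" "J > 0" "\<epsilon> > 0" and q: "q = (\<Prod>k<l. measure_pmf.prob p (A k))"
  shows "prob {\<omega> \<in> space M. \<bar>(\<Sum>j<J. window A l (r + j * l) \<omega>) - real J * q\<bar> \<ge> \<epsilon> * real J}
           \<le> 2 * exp (- 2 * \<epsilon>\<^sup>2 * real J)"
proof -
  interpret Hoeffding_ineq M "{..<J}" "\<lambda>j. window A l (r + j * l)" "\<lambda>_. 0" "\<lambda>_. 1" "real J * q"
  proof unfold_locales
    show "indep_vars (\<lambda>_. borel) (\<lambda>j. window A l (r + j * l)) {..<J}"
      by (rule indep_windows) fact
    show "real J * q \<equiv> (\<Sum>j<J. expectation (window A l (r + j * l)))"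
      by (simp add: expectation_window q)
  qed (auto simp: window_def)
  have "prob {\<omega> \<in> space M. \<bar>(\<Sum>j<J. window A l (r + j * l) \<omega>) - real J * q\<bar> \<ge> \<epsilon> * real J}
      \<le> 2 * exp (- 2 * (\<epsilon> * real J)\<^sup>2 / (\<Sum>j<J. (1 - 0)\<^sup>2))"
    by (rule Hoeffding_ineq_abs_ge) (use assms in auto)
  also have "- 2 * (\<epsilon> * real J)\<^sup>2 / (\<Sum>j<J. (1 - 0)\<^sup>2) = - 2 * \<epsilon>\<^sup>2 * real J"
    using \<open>J > 0\<close> by (simp add: power2_eq_square)
  finally show ?thesis .
qed

text \<open>
  Overlapping windows are dependent. Sorting the starting points by their residue modulo \<open>l\<close>
  gives \<open>l\<close> families of independent windows, each of which obeys Hoeffding's inequality.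
  The incomplete last block of fewer than \<open>l\<close> windows accounts for the additive \<open>l\<close>.
\<close>

lemma window_concentration:
  assumes "l > 0" "\<epsilon> > 0" and q: "q = (\<Prod>k<l. measure_pmf.prob p (A k))"
  shows "\<exists>C. \<exists>c>0. \<forall>m. prob {\<omega> \<in> space M. \<bar>(\<Sum>i<m. window A l i \<omega>) - real m * q\<bar> \<ge> \<epsilon> * real m + real l}
           \<le> C * exp (- c * real m)"
proof (intro exI conjI allI)
  \<comment> \<open>The rate comes from \<open>J \<ge> m / l - 1\<close>; the lost block goes into the constant.\<close>
  let ?c = "2 * \<epsilon>\<^sup>2 / real l"
  let ?C = "2 * real l * exp (2 * \<epsilon>\<^sup>2)"
  show "?c > 0" using assms by simp
  fix m :: nat
  let ?E = "{\<omega> \<in> space M. \<bar>(\<Sum>i<m. window A l i \<omega>) - real m * q\<bar> \<ge> \<epsilon> * real m + real l}"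
  define J where "J = m div l"
  have q01: "0 \<le> q" "q \<le> 1" unfolding q by (auto intro!: prod_nonneg prod_le_1)
  have m: "J * l \<le> m" "m < J * l + l"
    using dividend_less_div_times[OF \<open>l > 0\<close>, of m] by (simp_all add: J_def)
  have "prob ?E \<le> 2 * real l * exp (- 2 * \<epsilon>\<^sup>2 * real J)"
  \<comment> \<open>Words shorter than one window: the bound exceeds 1.\<close>
  proof (cases "J = 0")
    case True
    have "prob ?E \<le> 1" by simp
    also have "\<dots> \<le> 2 * real l" using \<open>l > 0\<close> by simp
    finally show ?thesis using True by simp
  next
    case False
    let ?B = "\<lambda>r. {\<omega> \<in> space M. \<bar>(\<Sum>j<J. window A l (r + j * l) \<omega>) - real J * q\<bar> \<ge> \<epsilon> * real J}"
    have "?E \<subseteq> (\<Union>r<l. ?B r)"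
    proof
      fix \<omega> assume \<omega>: "\<omega> \<in> ?E"
      show "\<omega> \<in> (\<Union>r<l. ?B r)"
      proof (rule ccontr)
        let ?w = "\<lambda>i. window A l i \<omega>"
        assume "\<omega> \<notin> (\<Union>r<l. ?B r)"
        then have small: "\<bar>(\<Sum>j<J. ?w (r + j * l)) - real J * q\<bar> < \<epsilon> * real J" if "r < l" for r
          using \<omega> that by (auto simp: not_le[symmetric])
        have "(\<Sum>i<J * l. ?w i) = (\<Sum>j<J. \<Sum>r<l. ?w (r + j * l))"
          by (simp add: sum.nat_group[symmetric] sum.atLeastLessThan_shift_0 atLeast0LessThan add.commute)
        also have "\<dots> = (\<Sum>r<l. \<Sum>j<J. ?w (r + j * l))" by (rule sum.swap)
        finally have "(\<Sum>i<J * l. ?w i) - real (J * l) * q = (\<Sum>r<l. (\<Sum>j<J. ?w (r + j * l)) - real J * q)"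
          by (simp add: sum_subtractf)
        also have "\<bar>\<dots>\<bar> \<le> (\<Sum>r<l. \<bar>(\<Sum>j<J. ?w (r + j * l)) - real J * q\<bar>)" by (rule sum_abs)
        also have "\<dots> < (\<Sum>r<l. \<epsilon> * real J)"
          using small \<open>l > 0\<close> by (intro sum_strict_mono) auto
        also have "\<dots> = \<epsilon> * real (J * l)" by simp
        also have "\<dots> \<le> \<epsilon> * real m" using m \<open>\<epsilon> > 0\<close> by (intro mult_left_mono) (auto simp flip: of_nat_mult)
        finally have *: "\<bar>(\<Sum>i<J * l. ?w i) - real (J * l) * q\<bar> < \<epsilon> * real m" .
        define D R where "D = real m - real (J * l)" and "R = (\<Sum>i\<in>{J * l..<m}. ?w i)"
        have D: "0 \<le> D" "D \<le> real l" using m by (simp_all add: D_def del: of_nat_mult)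
        have "0 \<le> R" unfolding R_def by (intro sum_nonneg) (simp add: window_def)
        have "R \<le> real (card {J * l..<m}) * 1"
          unfolding R_def by (rule sum_bounded_above) (simp add: window_def)
        then have "R \<le> D" using m(1) by (simp add: D_def of_nat_diff del: of_nat_mult)
        have "0 \<le> D * q" "D * q \<le> D" using q01 D by (simp_all add: mult_left_le)
        have "(\<Sum>i<m. ?w i) = (\<Sum>i<J * l. ?w i) + R"
          unfolding R_def using sum.atLeastLessThan_concat[of 0 "J * l" m ?w] m(1)
          by (simp add: atLeast0LessThan)
        moreover have "real m * q = real (J * l) * q + D * q" by (simp add: D_def algebra_simps)
        ultimately have "\<bar>(\<Sum>i<m. ?w i) - real m * q\<bar> < \<epsilon> * real m + real l"
          using * D \<open>0 \<le> R\<close> \<open>R \<le> D\<close> \<open>0 \<le> D * q\<close> \<open>D * q \<le> D\<close> by linarith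
        then show False using \<omega> by simp
      qed
    qed
    then have "prob ?E \<le> prob (\<Union>r<l. ?B r)" by (intro finite_measure_mono) auto
    also have "\<dots> \<le> (\<Sum>r<l. prob (?B r))" by (intro finite_measure_subadditive_finite) auto
    also have "\<dots> \<le> (\<Sum>r<l. 2 * exp (- 2 * \<epsilon>\<^sup>2 * real J))"
      by (intro sum_mono spaced_window_concentration) (use assms False in auto)
    finally show ?thesis by simp
  qed
  also have "\<dots> \<le> 2 * real l * (exp (2 * \<epsilon>\<^sup>2) * exp (- ?c * real m))"
  proof -
    have "real m \<le> real (J * l + l)" using m(2) by (simp only: of_nat_le_iff)
    then have "real m / real l \<le> real J + 1" using \<open>l > 0\<close> by (simp add: field_simps)
    then have "2 * \<epsilon>\<^sup>2 * (real m / real l) \<le> 2 * \<epsilon>\<^sup>2 * (real J + 1)" by (intro mult_left_mono) auto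
    then have "- 2 * \<epsilon>\<^sup>2 * real J \<le> 2 * \<epsilon>\<^sup>2 + - ?c * real m" by (simp add: distrib_left)
    then have "exp (- 2 * \<epsilon>\<^sup>2 * real J) \<le> exp (2 * \<epsilon>\<^sup>2) * exp (- ?c * real m)"
      unfolding exp_add[symmetric] by (simp only: exp_le_cancel_iff)
    then show ?thesis by (intro mult_left_mono) auto
  qed
  finally show "prob ?E \<le> ?C * exp (- ?c * real m)" by (simp only: mult.assoc)
qed

end

section \<open>Slowly varying functions\<close>

text \<open>
  This is the measure-theoretic core of the uniform convergence theorem for slowly varying
  functions. By dominated convergence, for large \<open>x\<close> the shifts \<open>v\<close> in \<open>{0..2}\<close> that change \<open>h\<close> at \<open>x\<close>
  by more than \<open>1 / 2\<close> have measure below \<open>1 / 2\<close>, and so have those at \<open>x + u\<close>. The two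
  exceptional sets cannot cover an interval of length 1, so some point is reached by a good shift
  from both \<open>x\<close> and \<open>x + u\<close>.
\<close>

lemma bounded_shifts_if_shifts_tend_to_zero:
  fixes h :: "real \<Rightarrow> real"
  assumes [measurable]: "h \<in> borel_measurable borel"
    and lim: "\<And>v. ((\<lambda>x. h (x + v) - h x) \<longlongrightarrow> 0) at_top"
  shows "\<exists>x0. \<forall>x\<ge>x0. \<forall>u\<in>{0..1}. \<bar>h (x + u) - h x\<bar> \<le> 1"
proof -
  define bad where "bad = (\<lambda>x. {v \<in> {0..2}. \<bar>h (x + v) - h x\<bar> > 1 / 2})"
  have [measurable]: "bad x \<in> sets borel" for x
    unfolding bad_def by measurable
  have "((\<lambda>x. integral\<^sup>L lborel (indicator (bad x) :: real \<Rightarrow> real)) \<longlongrightarrow> integral\<^sup>L lborel (\<lambda>_::real. 0 :: real)) at_top"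
  proof (rule integral_dominated_convergence_at_top)
    show "integrable lborel (indicator {0..2} :: real \<Rightarrow> real)" by simp
    show "\<forall>\<^sub>F x in at_top. AE v in lborel. norm (indicator (bad x) v :: real) \<le> indicator {0..2} v"
      by (auto simp: bad_def indicator_def)
    have "\<forall>\<^sub>F x in at_top. v \<notin> bad x" for v
      using tendstoD[OF lim[of v], of "1 / 2"]
      by (auto elim!: eventually_mono simp: bad_def dist_real_def)
    then show "AE v in lborel. ((\<lambda>x. indicator (bad x) v :: real) \<longlongrightarrow> 0) at_top"
      by (intro AE_I2 tendsto_eventually) (auto elim!: eventually_mono simp: indicator_def)
  qed auto
  then have "((\<lambda>x. measure lborel (bad x)) \<longlongrightarrow> 0) at_top" by simp
  then have "\<forall>\<^sub>F x in at_top. measure lborel (bad x) < 1 / 2"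
    by (rule order_tendstoD) simp
  then obtain x0 where x0: "\<And>x. x \<ge> x0 \<Longrightarrow> measure lborel (bad x) < 1 / 2"
    by (auto simp: eventually_at_top_linorder)
  have "\<bar>h (x + u) - h x\<bar> \<le> 1" if "x \<ge> x0" "u \<in> {0..1}" for x u
  proof -
    \<comment> \<open>The bad shifts at \<open>x + u\<close>, translated so that they refer to the same points as those at \<open>x\<close>.\<close>
    define W where "W = (+) (- u) -` bad (x + u)"
    have [measurable]: "W \<in> sets borel"
      unfolding W_def by (rule measurable_sets_borel[of _ borel]) measurable
    have "measure lborel (bad (x + u)) = measure (distr lborel borel ((+) (- u))) (bad (x + u))"
      by (simp only: lborel_distr_plus)
    also have "\<dots> = measure lborel W"
      by (subst measure_distr) (auto simp: W_def)
    finally have W: "measure lborel W < 1 / 2" using x0[of "x + u"] that by simp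
    have sub: "bad x \<subseteq> {0..2}" "W \<subseteq> {0..3}" using that by (auto simp: bad_def W_def)
    have fin: "emeasure lborel (bad x) \<noteq> \<infinity>" "emeasure lborel W \<noteq> \<infinity>"
      using emeasure_mono[OF sub(1), of lborel] emeasure_mono[OF sub(2), of lborel]
      by (auto simp: top_unique)
    have "\<not> {1..2} \<subseteq> bad x \<union> W"
    proof
      assume "{1..2} \<subseteq> bad x \<union> W"
      moreover have "emeasure lborel (bad x \<union> W) \<le> emeasure lborel (bad x) + emeasure lborel W"
        by (rule emeasure_subadditive) auto
      then have "emeasure lborel (bad x \<union> W) \<noteq> \<infinity>" using fin by (auto simp: top_unique)
      ultimately have "measure lborel {1..2::real} \<le> measure lborel (bad x \<union> W)"
        by (intro measure_mono_fmeasurable) (auto simp: fmeasurable_def less_top)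
      also have "\<dots> \<le> measure lborel (bad x) + measure lborel W"
        by (rule measure_Un_le) auto
      also have "\<dots> < 1" using W x0[OF that(1)] by simp
      finally show False by simp
    qed
    then obtain v where "v \<in> {1..2}" "v \<notin> bad x" "v \<notin> W" by blast
    then have "\<bar>h (x + v) - h x\<bar> \<le> 1 / 2" "\<bar>h (x + v) - h (x + u)\<bar> \<le> 1 / 2"
      using that by (auto simp: bad_def W_def not_less)
    then show ?thesis by linarith
  qed
  then show ?thesis by blast
qed

text \<open>
  In logarithmic coordinates, \<open>ln f\<close> drops by at most 1 on each unit step, so \<open>f\<close> decays at
  most like \<open>1 / x\<close>.
\<close>

lemma slowly_varying_lower_bound:
  assumes "slowly_varying f"
  shows "\<exists>K>0. \<forall>\<^sub>F x in at_top. K / x \<le> f x"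
proof -
  obtain a where pos: "\<And>x. x \<ge> a \<Longrightarrow> f x > 0"
    and meas: "f \<in> borel_measurable (restrict_space borel {a..})"
    and lim: "\<And>t. t > 0 \<Longrightarrow> ((\<lambda>x. f (t * x) / f x) \<longlongrightarrow> 1) at_top"
    using assms by (auto simp: slowly_varying_def)
  \<comment> \<open>Modified below \<open>a\<close>, where \<open>f\<close> may be neither positive nor measurable.\<close>
  define g where "g = (\<lambda>x. if x \<in> {a..} then f x else 1)"
  define h where "h = (\<lambda>y. ln (g (exp y)))"
  have [measurable]: "g \<in> borel_measurable borel"
    unfolding g_def using meas
    by (subst (asm) measurable_restrict_space_iff[where c = 1]) auto
  have "h \<in> borel_measurable borel" unfolding h_def by measurable
  moreover have "((\<lambda>x. h (x + v) - h x) \<longlongrightarrow> 0) at_top" for v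
  proof -
    have "((\<lambda>x. f (exp v * exp x) / f (exp x)) \<longlongrightarrow> 1) at_top"
      by (rule filterlim_compose[OF lim exp_at_top]) simp
    then have "((\<lambda>x. ln (f (exp v * exp x) / f (exp x))) \<longlongrightarrow> 0) at_top"
      using tendsto_ln[of _ "1::real"] by simp
    moreover have "\<forall>\<^sub>F x in at_top. exp x \<ge> a" "\<forall>\<^sub>F x in at_top. exp (x + v) \<ge> a"
      by real_asymp+
    then have "\<forall>\<^sub>F x in at_top. ln (f (exp v * exp x) / f (exp x)) = h (x + v) - h x"
    proof eventually_elim
      case (elim x)
      then have "f (exp x) > 0" "f (exp (x + v)) > 0" using pos by auto
      then show ?case using elim by (simp add: h_def g_def ln_div exp_add mult.commute)
    qed
    ultimately show ?thesis by (rule Lim_transform_eventually)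
  qed
  ultimately obtain x0 where x0: "\<And>x u. x \<ge> x0 \<Longrightarrow> u \<in> {0..1} \<Longrightarrow> \<bar>h (x + u) - h x\<bar> \<le> 1"
    using bounded_shifts_if_shifts_tend_to_zero by blast
  have step: "h (x0 + real k) \<ge> h x0 - real k" for k
  proof (induction k)
    case (Suc k)
    have "\<bar>h (x0 + real k + 1) - h (x0 + real k)\<bar> \<le> 1" by (rule x0) auto
    with Suc show ?case by (simp add: algebra_simps abs_le_iff)
  qed simp
  have lower: "h x \<ge> h x0 - (x - x0) - 1" if "x \<ge> x0" for x
  proof -
    define k where "k = nat \<lfloor>x - x0\<rfloor>"
    have k: "real k \<le> x - x0" "x - x0 < real k + 1" using that by (auto simp: k_def)
    have "\<bar>h (x0 + real k + (x - x0 - real k)) - h (x0 + real k)\<bar> \<le> 1" by (rule x0) (use k in auto)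
    then show ?thesis using step[of k] k by (simp add: abs_le_iff)
  qed
  have "\<forall>\<^sub>F x in at_top. x \<ge> max (max a 1) (exp x0)" by (rule eventually_ge_at_top)
  then have "\<forall>\<^sub>F x in at_top. exp (h x0 + x0 - 1) / x \<le> f x"
  proof eventually_elim
    case (elim x)
    then have x: "x \<ge> a" "x > 0" "ln x \<ge> x0" by (auto simp: ln_ge_iff)
    then have "exp (h x0 + x0 - 1) / x = exp (h x0 - (ln x - x0) - 1)"
      by (simp add: exp_diff exp_add)
    also have "\<dots> \<le> exp (h (ln x))" using lower[of "ln x"] x by simp
    also have "\<dots> = f x" using x pos by (simp add: h_def g_def)
    finally show ?case .
  qed
  then show ?thesis by (intro exI[of _ "exp (h x0 + x0 - 1)"]) simp
qed

lemma regularly_varying_pmf_subexponential: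
  fixes p :: "nat pmf" and f :: "real \<Rightarrow> real"
  assumes "slowly_varying f"
    and tail: "\<forall>\<^sub>F n in sequentially. pmf p n = f (real n) * real n powr (- 1 - \<alpha>)"
    and "\<delta> > 0"
  shows "\<forall>\<^sub>F n in sequentially. pmf p n \<ge> exp (- \<delta> * real n)"
proof -
  obtain K where "K > 0" and K: "\<forall>\<^sub>F x in at_top. K / x \<le> f x"
    using slowly_varying_lower_bound[OF assms(1)] by blast
  have "\<forall>\<^sub>F n in sequentially. K / real n \<le> f (real n)"
    by (rule eventually_compose_filterlim[OF K filterlim_real_sequentially])
  moreover have "\<forall>\<^sub>F n in sequentially. exp (- \<delta> * real n) \<le> K / real n * real n powr (- 1 - \<alpha>)"
    using \<open>K > 0\<close> \<open>\<delta> > 0\<close> by real_asymp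
  ultimately show ?thesis using tail
  proof eventually_elim
    case (elim n)
    have "K / real n * real n powr (- 1 - \<alpha>) \<le> f (real n) * real n powr (- 1 - \<alpha>)"
      using elim by (intro mult_right_mono) auto
    then show ?case using elim by simp
  qed
qed

section \<open>The number of marked vertices is not exponentially unlikely\<close>

lemma coeff_mult_nonneg:
  fixes P Q :: "real poly"
  assumes "\<And>i. coeff P i \<ge> 0" "\<And>i. coeff Q i \<ge> 0"
  shows "coeff (P * Q) n \<ge> 0"
  unfolding coeff_mult by (intro sum_nonneg mult_nonneg_nonneg assms)

lemma coeff_power_nonneg:
  fixes P :: "real poly"
  assumes "\<And>i. coeff P i \<ge> 0"
  shows "coeff (P ^ k) n \<ge> 0"
proof (induction k arbitrary: n)
  case 0
  then show ?case by (cases n) auto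
next
  case (Suc k)
  then show ?case using assms by (auto intro!: coeff_mult_nonneg)
qed

lemma coeff_mult_ge:
  fixes P Q :: "real poly"
  assumes "\<And>i. coeff P i \<ge> 0" "\<And>i. coeff Q i \<ge> 0"
  shows "coeff P a * coeff Q b \<le> coeff (P * Q) (a + b)"
proof -
  have "coeff P a * coeff Q (a + b - a) \<le> (\<Sum>i\<le>a + b. coeff P i * coeff Q (a + b - i))"
    by (rule member_le_sum) (use assms in auto)
  then show ?thesis by (simp add: coeff_mult)
qed

lemma coeff_power_ge:
  fixes P :: "real poly"
  assumes "\<And>i. coeff P i \<ge> 0"
  shows "coeff P s ^ j \<le> coeff (P ^ j) (j * s)"
proof (induction j)
  case (Suc j)
  have "coeff P s * coeff P s ^ j \<le> coeff P s * coeff (P ^ j) (j * s)"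
    by (intro mult_left_mono Suc assms)
  also have "\<dots> \<le> coeff (P * P ^ j) (s + j * s)"
    by (intro coeff_mult_ge assms coeff_power_nonneg)
  finally show ?case by simp
qed simp

text \<open>
  For a polynomial with nonnegative coefficients, the value of \<open>G ^ k\<close> at 1 is the total
  mass of its coefficients, and its value at \<open>1 / 2\<close> bounds the mass of the low ones, as in Chernoff's
  method. If the claim failed, all coefficients beyond \<open>c * k\<close> would be exponentially small. There are
  only linearly many of them, so the total mass \<open>poly G 1 ^ k\<close> would be too small for large \<open>k\<close>.
\<close>

lemma exists_large_coeff_power:
  fixes G :: "real poly"
  assumes nonneg: "\<And>i. coeff G i \<ge> 0"
    and half: "2 powr c * poly G (1 / 2) \<le> \<rho>"
    and one: "\<rho> < poly G 1" "exp (- \<delta> * c) < poly G 1"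
    and "\<delta> > 0"
  shows "\<exists>k>0. \<exists>s. c * real k \<le> real s \<and> exp (- \<delta> * real s) \<le> coeff (G ^ k) s"
proof (rule ccontr)
  assume *: "\<not> ?thesis"
  define q D r where "q = poly G 1" and "D = degree G" and "r = max \<rho> (exp (- \<delta> * c))"
  have r: "0 < r" "r < q" using one unfolding r_def q_def by (auto simp: less_max_iff_disj)
  have half0: "poly G (1 / 2) \<ge> 0" unfolding poly_altdef by (intro sum_nonneg mult_nonneg_nonneg nonneg) auto
  have bound: "q ^ k \<le> (real k * real D + 2) * r ^ k" if "k > 0" for k
  proof -
    let ?a = "coeff (G ^ k)" and ?d = "degree (G ^ k)"
    have a: "?a s \<ge> 0" for s by (intro coeff_power_nonneg nonneg)
    \<comment> \<open>Low coefficients, by weighing with the powers of \<open>1 / 2\<close>.\<close>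
    have small: "?a s \<le> 2 powr (c * real k) * (?a s * (1 / 2) ^ s)" if "real s < c * real k" for s
    proof -
      have "1 = 2 powr (real s) * (1 / 2) ^ s" by (simp add: powr_realpow power_one_over)
      also have "\<dots> \<le> 2 powr (c * real k) * (1 / 2) ^ s"
        using that by (intro mult_right_mono powr_mono) auto
      finally show ?thesis using mult_left_mono[OF _ a[of s]] by (simp add: mult.left_commute) fastforce
    qed
    have large: "?a s \<le> r ^ k" if "\<not> real s < c * real k" for s
    proof -
      have "?a s \<le> exp (- \<delta> * real s)" using * \<open>k > 0\<close> that by (meson not_less linear)
      also have "\<dots> \<le> exp (- \<delta> * (c * real k))" using that \<open>\<delta> > 0\<close> by (simp add: mult_left_mono)
      also have "\<dots> = exp (- \<delta> * c) ^ k" by (simp add: exp_of_nat_mult[symmetric] algebra_simps)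
      also have "\<dots> \<le> r ^ k" by (intro power_mono) (auto simp: r_def)
      finally show ?thesis .
    qed
    have "q ^ k = (\<Sum>s\<le>?d. ?a s)" 
      unfolding q_def poly_power[symmetric] poly_altdef[of "G ^ k"] by simp
    also have "\<dots> \<le> (\<Sum>s\<le>?d. 2 powr (c * real k) * (?a s * (1 / 2) ^ s) + r ^ k)"
    proof (intro sum_mono)
      fix s
      have "0 \<le> 2 powr (c * real k) * (?a s * (1 / 2) ^ s)" "0 \<le> r ^ k" using a[of s] r by auto
      then show "?a s \<le> 2 powr (c * real k) * (?a s * (1 / 2) ^ s) + r ^ k"
        using small[of s] large[of s] by (cases "real s < c * real k") linarith+
    qed
    also have "\<dots> = 2 powr (c * real k) * poly (G ^ k) (1 / 2) + real (Suc ?d) * r ^ k"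
      by (simp add: sum.distrib sum_distrib_left poly_altdef del: poly_power)
    also have "2 powr (c * real k) * poly (G ^ k) (1 / 2) = (2 powr c * poly G (1 / 2)) ^ k"
      by (simp add: power_mult_distrib powr_powr[symmetric] powr_realpow)
    also have "\<dots> \<le> r ^ k" using half half0 by (intro power_mono) (auto simp: r_def)
    also have "real (Suc ?d) * r ^ k \<le> (real k * real D + 1) * r ^ k"
      using degree_power_le[of G k] r
      by (intro mult_right_mono) (auto simp: D_def mult.commute simp flip: of_nat_mult)
    finally show ?thesis by (simp add: algebra_simps)
  qed
  define x where "x = r / q"
  have x: "norm x < 1" using r by (simp add: x_def)
  have "(\<lambda>k. real D * (of_nat k * x ^ k) + 2 * x ^ k) \<longlonglongrightarrow> real D * 0 + 2 * 0"
    by (intro tendsto_intros powser_times_n_limit_0 LIMSEQ_power_zero x)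
  then have "\<forall>\<^sub>F k in sequentially. real D * (of_nat k * x ^ k) + 2 * x ^ k < 1"
    by (rule order_tendstoD) simp
  from eventually_happens'[OF sequentially_bot eventually_conj[OF this eventually_gt_at_top[of 0]]]
  obtain k where "k > 0" and k: "real D * (of_nat k * x ^ k) + 2 * x ^ k < 1" by auto
  have "(real k * real D + 2) * r ^ k = (real D * (of_nat k * x ^ k) + 2 * x ^ k) * q ^ k"
    using r by (simp add: x_def power_divide algebra_simps)
  also have "\<dots> < 1 * q ^ k" using k r by (intro mult_strict_right_mono) auto
  finally have "(real k * real D + 2) * r ^ k < q ^ k" by simp
  with bound[OF \<open>k > 0\<close>] show False by simp
qed

definition mark_count :: "nat set \<Rightarrow> ptree \<Rightarrow> nat" where
  "mark_count \<Omega> t = length (filter (\<lambda>k. k \<in> \<Omega>) (dfs_word t))"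

lemma mark_count_Node:
  "mark_count \<Omega> (Node ts) = of_bool (length ts \<in> \<Omega>) + sum_list (map (mark_count \<Omega>) ts)"
proof -
  have "length (filter (\<lambda>k. k \<in> \<Omega>) (concat (map dfs_word ts))) = sum_list (map (mark_count \<Omega>) ts)"
    by (induction ts) (auto simp: mark_count_def)
  then show ?thesis by (simp add: mark_count_def dfs_word_Node)
qed

lemma weight_Node: "weight p (Node ts) = pmf p (length ts) * prod_list (map (weight p) ts)"
proof -
  have "prod_list (map (pmf p) (concat (map dfs_word ts))) = prod_list (map (weight p) ts)"
    by (induction ts) (auto simp: weight_def)
  then show ?thesis by (simp add: weight_def dfs_word_Node)
qed

text \<open>
  These trees are used as fillers. Either a leaf is marked, or a marked vertex with only leaves as
  children does the job.
\<close>

lemma exists_tree_with_one_mark: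
  fixes p :: "nat pmf"
  assumes "pmf p 0 > 0" "measure_pmf.prob p \<Omega> > 0"
  shows "\<exists>t. mark_count \<Omega> t = 1 \<and> weight p t > 0"
proof (cases "0 \<in> \<Omega>")
  case True
  then show ?thesis using assms by (intro exI[of _ "Node []"]) (simp add: mark_count_Node weight_Node)
next
  case False
  obtain k where "k \<in> \<Omega>" "pmf p k > 0"
    using assms(2) by (metis disjoint_iff less_irrefl measure_pmf_zero_iff pmf_positive)
  then show ?thesis using False assms
    by (intro exI[of _ "Node (replicate k (Node []))"])
       (auto simp: mark_count_Node weight_Node sum_list_replicate)
qed

text \<open>
  The generating polynomial of the number of marks, restricted to trees from \<open>A\<close>. By
  \<open>coeff_mark_poly_power\<close> below, the coefficients of its powers are the probabilities of forests with
  a given number of marks.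
\<close>

definition mark_poly :: "nat pmf \<Rightarrow> nat set \<Rightarrow> ptree set \<Rightarrow> real poly" where
  "mark_poly p \<Omega> A = (\<Sum>t\<in>A. monom (weight p t) (mark_count \<Omega> t))"

lemma coeff_mark_poly_nonneg: "coeff (mark_poly p \<Omega> A) i \<ge> 0"
  by (auto simp: mark_poly_def coeff_sum intro!: sum_nonneg)

lemma coeff_mark_poly_power:
  assumes "finite A"
  shows "coeff (mark_poly p \<Omega> A ^ d) s
    = (\<Sum>ts | set ts \<subseteq> A \<and> length ts = d \<and> sum_list (map (mark_count \<Omega>) ts) = s. prod_list (map (weight p) ts))"
proof -
  let ?L = "{ts. set ts \<subseteq> A \<and> length ts = d}"
  have fin: "finite ?L" by (rule finite_lists_length_eq) fact
  have monom: "prod_list (map (\<lambda>t. monom (weight p t) (mark_count \<Omega> t)) ts)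
      = monom (prod_list (map (weight p) ts)) (sum_list (map (mark_count \<Omega>) ts))" for ts
    by (induction ts) (auto simp: mult_monom)
  have "coeff (mark_poly p \<Omega> A ^ d) s
      = (\<Sum>ts\<in>?L. if sum_list (map (mark_count \<Omega>) ts) = s then prod_list (map (weight p) ts) else 0)"
    unfolding mark_poly_def sum_prod_list_power[OF assms, symmetric] monom coeff_sum by simp
  also have "\<dots> = (\<Sum>ts\<in>{ts \<in> ?L. sum_list (map (mark_count \<Omega>) ts) = s}. prod_list (map (weight p) ts))"
    by (rule sum.inter_filter[OF fin, symmetric])
  finally show ?thesis by (simp add: conj_assoc)
qed

context galton_watson
begin

lemma prob_tree_event:
  assumes "finite A"
  shows "prob (tree_event A) = (\<Sum>t\<in>A. weight p t)"
  unfolding tree_event_def prob_GW_eq_verts[symmetric]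
  using assms disjoint_GW_eq_verts by (intro finite_measure_finite_Union) auto

lemma weight_le_1: "weight p t \<le> 1"
  unfolding prob_GW_eq_verts[symmetric] by (rule prob_le_1)

lemma sum_weight_le_1: "finite A \<Longrightarrow> (\<Sum>t\<in>A. weight p t) \<le> 1"
  by (simp flip: prob_tree_event)

lemma exists_finite_tree_set:
  assumes "integrable (measure_pmf p) real" "measure_pmf.expectation p real < 1" "\<theta> < 1"
  shows "\<exists>A. finite A \<and> \<tau> \<in> A \<and> \<theta> < (\<Sum>t\<in>A. weight p t)"
proof -
  define A where "A = (\<lambda>n. {t :: ptree. to_nat t \<le> n})"
  have fin: "finite (A n)" for n
    unfolding A_def by (rule finite_imageD[of to_nat]) (auto intro: finite_subset[of _ "{..n}"])
  have "(\<lambda>n. prob (tree_event (A n))) \<longlonglongrightarrow> prob (\<Union>n. tree_event (A n))"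
  proof (rule finite_Lim_measure_incseq)
    show "incseq (\<lambda>n. tree_event (A n))"
      unfolding incseq_def tree_event_def A_def by (intro allI impI UN_mono) auto
  qed auto
  also have "(\<Union>n. tree_event (A n)) = tree_event UNIV" by (auto simp: tree_event_def A_def)
  finally have "(\<lambda>n. prob (tree_event (A n))) \<longlonglongrightarrow> 1" using prob_tree_event_UNIV[OF assms(1,2)] by simp
  then have "\<forall>\<^sub>F n in sequentially. prob (tree_event (A n)) > \<theta>" using assms(3) by (rule order_tendstoD)
  then obtain n where "prob (tree_event (A n)) > \<theta>" by (auto simp: eventually_sequentially)
  then have "\<theta> < (\<Sum>t\<in>A n. weight p t)" using fin by (simp add: prob_tree_event)
  also have "\<dots> \<le> (\<Sum>t\<in>insert \<tau> (A n). weight p t)" using fin by (intro sum_mono2) auto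
  finally show ?thesis using fin by (intro exI[of _ "insert \<tau> (A n)"]) auto
qed

text \<open>
  For \<open>n > 0\<close> the event says that the set of marked vertices equals one of countably many
  finite sets. For \<open>n = 0\<close> the cardinality would also take the default value of infinite sets.
\<close>

lemma sets_outdegree_count:
  assumes "n > 0"
  shows "{\<omega> \<in> space M. outdegree_count \<Omega> (GW \<omega>) = n} \<in> sets M"
proof -
  have eq: "outdegree_count \<Omega> (GW \<omega>) = n \<longleftrightarrow>
      (\<exists>F\<in>{F. finite F \<and> card F = n}. \<forall>v. v \<in> F \<longleftrightarrow> v \<in> GW \<omega> \<and> X v \<omega> \<in> \<Omega>)" for \<omega>
  proof -
    let ?S = "{v \<in> GW \<omega>. X v \<omega> \<in> \<Omega>}"
    have "outdegree_count \<Omega> (GW \<omega>) = card ?S"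
      unfolding outdegree_count_def
      by (intro arg_cong[where f = card]) (auto simp: outdegree_galton_watson_tree)
    moreover have "card ?S = n \<longleftrightarrow> finite ?S \<and> card ?S = n" using assms card_gt_0_iff[of ?S] by auto
    moreover have "(\<forall>v. v \<in> F \<longleftrightarrow> v \<in> GW \<omega> \<and> X v \<omega> \<in> \<Omega>) \<longleftrightarrow> F = ?S" for F by auto
    ultimately show ?thesis by auto
  qed
  have "countable {F :: vertex set. finite F \<and> card F = n}"
    by (rule countable_subset[OF _ countable_Collect_finite]) auto
  then show ?thesis unfolding eq by (intro sets.sets_Collect_countable_Ex' sets.sets_Collect_countable_All) auto
qed

text \<open>
  One way to get \<open>n\<close> marked vertices: the root has degree \<open>d\<close> and its branches are trees
  from \<open>A\<close> with \<open>s\<close> marks in total.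
\<close>

lemma prob_outdegree_count_ge_coeff:
  assumes "finite A" "n > 0" "n = of_bool (d \<in> \<Omega>) + s"
  shows "pmf p d * coeff (mark_poly p \<Omega> A ^ d) s \<le> prob {\<omega> \<in> space M. outdegree_count \<Omega> (GW \<omega>) = n}"
proof -
  define L where "L = {ts. set ts \<subseteq> A \<and> length ts = d \<and> sum_list (map (mark_count \<Omega>) ts) = s}"
  have "finite {ts. set ts \<subseteq> A \<and> length ts = d}" by (rule finite_lists_length_eq) fact
  then have fin: "finite L" by (rule rev_finite_subset) (auto simp: L_def)
  have "pmf p d * coeff (mark_poly p \<Omega> A ^ d) s = (\<Sum>ts\<in>L. weight p (Node ts))"
    unfolding coeff_mark_poly_power[OF assms(1)] L_def[symmetric] sum_distrib_left
    by (intro sum.cong) (auto simp: L_def weight_Node)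
  also have "\<dots> = (\<Sum>t\<in>Node ` L. weight p t)" by (simp add: sum.reindex inj_on_def)
  also have "\<dots> = prob (tree_event (Node ` L))" using fin by (simp add: prob_tree_event)
  also have "\<dots> \<le> prob {\<omega> \<in> space M. outdegree_count \<Omega> (GW \<omega>) = n}"
  proof (rule finite_measure_mono)
    show "tree_event (Node ` L) \<subseteq> {\<omega> \<in> space M. outdegree_count \<Omega> (GW \<omega>) = n}"
      using assms(3) mark_count_Node[of \<Omega>]
      by (auto simp: tree_event_def outdegree_count_verts L_def mark_count_def)
  qed (rule sets_outdegree_count, fact)
  finally show ?thesis .
qed

text \<open>
  The ratio \<open>c\<close> of marks to trees must not depend on \<open>\<delta>\<close>, since it controls the root degree
  that is needed later. It comes from the filler tree \<open>\<tau>\<close> alone: as \<open>\<tau> \<in> A\<close>, the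
  value of the generating polynomial at \<open>1 / 2\<close> is at most \<open>\<beta> = 1 - weight p \<tau> / 2\<close>.
\<close>

lemma exists_cheap_forest:
  assumes "integrable (measure_pmf p) real" "measure_pmf.expectation p real < 1"
    and \<tau>: "mark_count \<Omega> \<tau> = 1" "weight p \<tau> > 0"
  shows "\<exists>c>0. \<forall>\<delta>>0. \<exists>A k s. finite A \<and> \<tau> \<in> A \<and> 0 < k \<and> c * real k \<le> real s \<and>
           exp (- \<delta> * real s) \<le> coeff (mark_poly p \<Omega> A ^ k) s"
proof -
  define \<beta> where "\<beta> = 1 - weight p \<tau> / 2"
  have \<beta>: "0 < \<beta>" "\<beta> < 1" using \<tau> weight_le_1[of \<tau>] by (auto simp: \<beta>_def)
  \<comment> \<open>Chosen such that \<open>2 powr c\<close> uses up only half of the logarithmic gap between \<open>\<beta>\<close> and 1.\<close>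
  define c where "c = ln (1 / \<beta>) / (2 * ln 2)"
  have "c > 0" unfolding c_def using \<beta> by (intro divide_pos_pos ln_gt_zero) auto
  have "2 powr c = exp (ln (1 / \<beta>) / 2)" by (simp add: powr_def c_def)
  also have "\<dots> = sqrt (1 / \<beta>)" using \<beta> by (simp add: ln_sqrt[symmetric])
  finally have c: "2 powr c * \<beta> = sqrt \<beta>"
    using \<beta> by (simp add: real_sqrt_divide) (metis less_imp_le real_div_sqrt)
  have "\<exists>A k s. finite A \<and> \<tau> \<in> A \<and> 0 < k \<and> c * real k \<le> real s \<and>
           exp (- \<delta> * real s) \<le> coeff (mark_poly p \<Omega> A ^ k) s" if "\<delta> > 0" for \<delta>
  proof -
    have "max (sqrt \<beta>) (exp (- \<delta> * c)) < 1" using \<beta> \<open>\<delta> > 0\<close> \<open>c > 0\<close> by simp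
    then obtain A where A: "finite A" "\<tau> \<in> A" "max (sqrt \<beta>) (exp (- \<delta> * c)) < (\<Sum>t\<in>A. weight p t)"
      using exists_finite_tree_set[OF assms(1,2)] by blast
    let ?G = "mark_poly p \<Omega> A"
    have "poly ?G (1 / 2) = (\<Sum>t\<in>A. weight p t * (1 / 2) ^ mark_count \<Omega> t)"
      by (simp add: mark_poly_def poly_sum poly_monom)
    also have "\<dots> = weight p \<tau> / 2 + (\<Sum>t\<in>A - {\<tau>}. weight p t * (1 / 2) ^ mark_count \<Omega> t)"
      using A \<tau> by (simp add: sum.remove)
    also have "\<dots> \<le> weight p \<tau> / 2 + (\<Sum>t\<in>A - {\<tau>}. weight p t)"
      by (intro add_left_mono sum_mono mult_left_le power_le_one) auto
    also have "\<dots> = (\<Sum>t\<in>A. weight p t) - weight p \<tau> / 2" using A by (simp add: sum.remove)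
    also have "\<dots> \<le> \<beta>" using sum_weight_le_1[OF A(1)] by (simp add: \<beta>_def)
    finally have "2 powr c * poly ?G (1 / 2) \<le> 2 powr c * \<beta>" by (intro mult_left_mono) auto
    moreover have "poly ?G 1 = (\<Sum>t\<in>A. weight p t)" by (simp add: mark_poly_def poly_sum poly_monom)
    ultimately show ?thesis
      using exists_large_coeff_power[of ?G c "sqrt \<beta>" \<delta>] A \<open>\<delta> > 0\<close> coeff_mark_poly_nonneg
      unfolding c by fastforce
  qed
  then show ?thesis using \<open>c > 0\<close> by blast
qed

text \<open>
  Take a block of \<open>k\<close> trees with \<open>s\<close> marks that is cheap in the sense of the previous lemma.
  A forest of \<open>j\<close> such blocks and \<open>r < s\<close> fillers has \<open>j * s + r\<close> marks, and it is attached to a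
  root of degree \<open>j * k + r\<close>. For large degrees whether the root itself is marked is
  constant, because \<open>\<Omega>\<close> or its complement is finite; \<open>e\<close> accounts for the root.
\<close>

lemma prob_outdegree_count_subexponential:
  assumes "integrable (measure_pmf p) real" "measure_pmf.expectation p real < 1"
    and "pmf p 0 > 0" "measure_pmf.prob p \<Omega> > 0" "finite \<Omega> \<or> finite (- \<Omega>)"
    and subexp: "\<And>\<delta>. \<delta> > 0 \<Longrightarrow> \<forall>\<^sub>F d in sequentially. pmf p d \<ge> exp (- \<delta> * real d)"
    and "\<delta> > 0"
  shows "\<forall>\<^sub>F n in sequentially. exp (- \<delta> * real n) \<le> prob {\<omega> \<in> space M. outdegree_count \<Omega> (GW \<omega>) = n}"
proof -
  obtain \<tau> where \<tau>: "mark_count \<Omega> \<tau> = 1" "weight p \<tau> > 0"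
    using exists_tree_with_one_mark assms(3,4) by blast
  obtain c where "c > 0" and c: "\<And>\<delta>. \<delta> > 0 \<Longrightarrow> \<exists>A k s. finite A \<and> \<tau> \<in> A \<and> 0 < k \<and> c * real k \<le> real s \<and>
           exp (- \<delta> * real s) \<le> coeff (mark_poly p \<Omega> A ^ k) s"
    using exists_cheap_forest[OF assms(1,2) \<tau>] by blast
  obtain A k s where A: "finite A" "\<tau> \<in> A" and "0 < k" and ks: "c * real k \<le> real s"
    and forest: "exp (- (\<delta> / 4) * real s) \<le> coeff (mark_poly p \<Omega> A ^ k) s"
    using c[of "\<delta> / 4"] \<open>\<delta> > 0\<close> by auto
  have "0 < c * real k" using \<open>c > 0\<close> \<open>0 < k\<close> by simp
  then have "s > 0" using ks by simp
  define e where "e = (if finite \<Omega> then 0 else 1 :: nat)"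
  obtain D0 where D0: "\<And>d. d \<ge> D0 \<Longrightarrow> of_bool (d \<in> \<Omega>) = e"
  proof -
    obtain B where "(if finite \<Omega> then \<Omega> else - \<Omega>) \<subseteq> {..<B}"
      using assms(5) finite_nat_iff_bounded by (metis (full_types))
    then have "of_bool (d \<in> \<Omega>) = e" if "d \<ge> B" for d
      using that by (auto simp: e_def split: if_splits)
    then show ?thesis using that by blast
  qed
  \<comment> \<open>Up to a bounded term, the root degree is at most \<open>n / c\<close>, so this rate costs \<open>\<delta> / 4\<close> per mark.\<close>
  define \<delta>2 where "\<delta>2 = \<delta> * c / 4"
  have "\<delta>2 > 0" using \<open>\<delta> > 0\<close> \<open>c > 0\<close> by (simp add: \<delta>2_def)
  obtain D1 where D1: "\<And>d. d \<ge> D1 \<Longrightarrow> pmf p d \<ge> exp (- \<delta>2 * real d)"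
    using subexp[OF \<open>\<delta>2 > 0\<close>] by (auto simp: eventually_sequentially)
  \<comment> \<open>The bounded costs: at most \<open>s\<close> fillers, and their contribution to the root degree.\<close>
  define K where "K = exp (- \<delta>2 * real s) * weight p \<tau> ^ s"
  have "K > 0" using \<tau> by (simp add: K_def)
  then have "\<forall>\<^sub>F n in sequentially. exp (- \<delta> * real n) \<le> K * exp (- (\<delta> / 2) * real n)"
    using \<open>\<delta> > 0\<close> by real_asymp
  moreover have "\<forall>\<^sub>F n in sequentially. n \<ge> max D0 D1 * s + 2" by (rule eventually_ge_at_top)
  ultimately show ?thesis
  proof eventually_elim
    case (elim n)
    let ?G = "mark_poly p \<Omega> A"
    define j r d where "j = (n - e) div s" and "r = (n - e) mod s" and "d = j * k + r"
    have e: "e \<le> 1" by (simp add: e_def)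
    have n: "n - e = j * s + r" "r < s" using \<open>s > 0\<close> by (simp_all add: j_def r_def)
    have "max D0 D1 * s div s \<le> j" unfolding j_def using elim(2) e by (intro div_le_mono) linarith
    then have "max D0 D1 \<le> j" using \<open>s > 0\<close> by simp
    also have "j \<le> j * k" using \<open>0 < k\<close> by simp
    finally have d: "D0 \<le> d" "D1 \<le> d" by (auto simp: d_def)
    have "weight p \<tau> \<le> coeff ?G 1"
      using A \<tau> member_le_sum[of \<tau> A "\<lambda>t. coeff (monom (weight p t) (mark_count \<Omega> t)) 1"]
      by (simp add: mark_poly_def coeff_sum)
    then have "weight p \<tau> ^ r \<le> coeff ?G 1 ^ r" using \<tau> by (intro power_mono) auto
    also have "\<dots> \<le> coeff (?G ^ r) r"
      using coeff_power_ge[OF coeff_mark_poly_nonneg, of p \<Omega> A 1 r] by simp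
    finally have filler: "weight p \<tau> ^ r \<le> coeff (?G ^ r) r" .
    have "exp (- (\<delta> / 4) * real s) ^ j \<le> coeff (?G ^ k) s ^ j" by (intro power_mono forest) auto
    also have "\<dots> \<le> coeff ((?G ^ k) ^ j) (j * s)"
      by (intro coeff_power_ge coeff_power_nonneg coeff_mark_poly_nonneg)
    finally have "exp (- (\<delta> / 4) * real s) ^ j * weight p \<tau> ^ r \<le> coeff ((?G ^ k) ^ j) (j * s) * coeff (?G ^ r) r"
      using filler \<tau> by (intro mult_mono) (auto intro!: coeff_power_nonneg coeff_mark_poly_nonneg)
    also have "\<dots> \<le> coeff ((?G ^ k) ^ j * ?G ^ r) (j * s + r)"
      by (intro coeff_mult_ge coeff_power_nonneg coeff_mark_poly_nonneg)
    also have "\<dots> = coeff (?G ^ d) (n - e)"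
      by (simp add: n d_def power_mult[symmetric] power_add mult.commute)
    finally have coeff: "exp (- (\<delta> / 4) * real s) ^ j * weight p \<tau> ^ r \<le> coeff (?G ^ d) (n - e)" .
    have js: "real j * real s \<le> real n"
    proof -
      have "j * s \<le> n" using n by linarith
      then show ?thesis by (metis of_nat_le_iff of_nat_mult)
    qed
    have "c * real d = real j * (c * real k) + c * real r" by (simp add: d_def algebra_simps)
    also have "\<dots> \<le> real j * real s + c * real s"
      using ks \<open>c > 0\<close> n by (intro add_mono mult_left_mono) auto
    also have "\<dots> \<le> real n + c * real s" using js by simp
    finally have "\<delta> / 4 * (c * real d) \<le> \<delta> / 4 * (real n + c * real s)"
      using \<open>\<delta> > 0\<close> by (intro mult_left_mono) auto
    then have deg: "\<delta>2 * real d \<le> \<delta> / 4 * real n + \<delta>2 * real s" by (simp add: \<delta>2_def algebra_simps)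
    have "\<delta> / 4 * (real j * real s) \<le> \<delta> / 4 * real n" using js \<open>\<delta> > 0\<close> by (intro mult_left_mono) auto
    then have "exp (- (\<delta> / 4) * real n) \<le> exp (- (\<delta> / 4) * real s) ^ j"
      by (simp add: exp_of_nat_mult[symmetric] algebra_simps)
    moreover have "weight p \<tau> ^ s \<le> weight p \<tau> ^ r" using n weight_le_1 by (intro power_decreasing) auto
    ultimately have "exp (- (\<delta> / 4) * real n) * weight p \<tau> ^ s \<le> coeff (?G ^ d) (n - e)"
      using coeff by (intro order_trans[OF mult_mono coeff]) auto
    moreover have "exp (- (\<delta> / 4 * real n + \<delta>2 * real s)) \<le> pmf p d"
      using D1[OF d(2)] deg by (intro order_trans[OF _ D1[OF d(2)]]) simp
    ultimately have "exp (- (\<delta> / 4 * real n + \<delta>2 * real s)) * (exp (- (\<delta> / 4) * real n) * weight p \<tau> ^ s)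
        \<le> pmf p d * coeff (?G ^ d) (n - e)"
      by (intro mult_mono) auto
    also have "\<dots> \<le> prob {\<omega> \<in> space M. outdegree_count \<Omega> (GW \<omega>) = n}"
      using elim(2) e D0[OF d(1)] A by (intro prob_outdegree_count_ge_coeff) auto
    also have "exp (- (\<delta> / 4 * real n + \<delta>2 * real s)) = exp (- (\<delta> / 4) * real n) * exp (- \<delta>2 * real s)"
      unfolding exp_add[symmetric] by simp
    also have "exp (- (\<delta> / 4) * real n) * exp (- \<delta>2 * real s) * (exp (- (\<delta> / 4) * real n) * weight p \<tau> ^ s)
        = K * (exp (- (\<delta> / 4) * real n) * exp (- (\<delta> / 4) * real n))"
      by (simp add: K_def)
    also have "exp (- (\<delta> / 4) * real n) * exp (- (\<delta> / 4) * real n) = exp (- (\<delta> / 2) * real n)"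
      unfolding exp_add[symmetric] by (simp add: field_simps)
    finally show ?case using elim(1) by linarith
  qed
qed

end

section \<open>Concentration under the condition\<close>

definition atypical_word :: "nat pmf \<Rightarrow> nat set \<Rightarrow> nat list \<Rightarrow> real \<Rightarrow> nat list \<Rightarrow> bool" where
  "atypical_word p \<Omega> w \<eta> xs \<longleftrightarrow>
     \<bar>real (length (filter (\<lambda>k. k \<in> \<Omega>) xs)) - real (length xs) * measure_pmf.prob p \<Omega>\<bar> \<ge> \<eta> * real (length xs) \<or>
     \<bar>real (occurrences w xs) - real (length xs) * prod_list (map (pmf p) w)\<bar> \<ge> \<eta> * real (length xs)"

text \<open>
  Here \<open>m\<close> is the size of the tree and \<open>N\<close> its fringe count. Since \<open>\<eta> \<le> \<pi> / 2\<close>, having \<open>n\<close> marks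
  forces \<open>m * \<pi> < 2 * n\<close>; this turns errors proportional to \<open>m\<close> into errors proportional to \<open>n\<close>.
\<close>

lemma typical_word_ratios:
  fixes \<pi> P \<epsilon> \<eta> m N :: real and n :: nat
  assumes "n > 0" "0 < \<pi>" "\<pi> \<le> 1" "0 \<le> P" "P \<le> 1" "\<epsilon> > 0" "m \<ge> 0"
    and \<eta>: "0 < \<eta>" "\<eta> \<le> \<pi> / 2" "\<eta> \<le> \<epsilon> * \<pi>\<^sup>2 / 4"
    and marks: "\<bar>real n - m * \<pi>\<bar> < \<eta> * m" and occ: "\<bar>N - m * P\<bar> < \<eta> * m"
  shows "\<bar>N / (real n * inverse \<pi>) - P\<bar> < \<epsilon>" "\<bar>m - real n * inverse \<pi>\<bar> < \<epsilon> * real n"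
proof -
  have "m * (\<pi> / 2) \<le> m * (\<pi> - \<eta>)" using \<eta> \<open>m \<ge> 0\<close> by (intro mult_left_mono) auto
  also have "\<dots> < real n" using marks by (simp add: algebra_simps abs_less_iff)
  finally have m: "m * \<pi> < 2 * real n" by simp
  have "\<eta> * m * 2 \<le> \<epsilon> * \<pi>\<^sup>2 / 4 * m * 2" using \<eta> \<open>m \<ge> 0\<close> by (intro mult_right_mono) auto
  also have "\<dots> = \<epsilon> * \<pi> / 2 * (m * \<pi>)" by (simp add: power2_eq_square)
  also have "\<dots> \<le> \<epsilon> * \<pi> / 2 * (2 * real n)" using m assms by (intro mult_left_mono) auto
  finally have small: "2 * (\<eta> * m) \<le> \<epsilon> * \<pi> * real n" by (simp add: algebra_simps)
  have "\<epsilon> * \<pi> * real n \<le> \<epsilon> * 1 * real n" using assms by (intro mult_right_mono mult_left_mono) auto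
  with small have small': "2 * (\<eta> * m) \<le> \<epsilon> * real n" by simp
  have pos: "0 < \<eta> * m" using marks by linarith
  have "\<bar>m - real n * inverse \<pi>\<bar> = \<bar>real n - m * \<pi>\<bar> / \<pi>"
    using \<open>0 < \<pi>\<close> by (simp add: abs_divide[symmetric] divide_simps del: abs_divide) (simp add: abs_minus_commute)
  also have "\<dots> < \<epsilon> * real n"
    using marks small pos \<open>0 < \<pi>\<close> by (simp add: divide_simps mult_ac)
  finally show "\<bar>m - real n * inverse \<pi>\<bar> < \<epsilon> * real n" .
  have "\<bar>N * \<pi> - real n * P\<bar> = \<bar>\<pi> * (N - m * P) + P * (m * \<pi> - real n)\<bar>" by (simp add: algebra_simps)
  also have "\<dots> \<le> \<pi> * \<bar>N - m * P\<bar> + P * \<bar>real n - m * \<pi>\<bar>"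
    using assms(2,4) abs_triangle_ineq[of "\<pi> * (N - m * P)" "P * (m * \<pi> - real n)"]
    by (simp add: abs_mult abs_minus_commute)
  also have "\<dots> \<le> 1 * \<bar>N - m * P\<bar> + 1 * \<bar>real n - m * \<pi>\<bar>"
    using assms by (intro add_mono mult_right_mono) auto
  also have "\<dots> < \<eta> * m + \<eta> * m" unfolding mult_1 by (rule add_strict_mono[OF occ marks])
  also have "\<dots> \<le> \<epsilon> * real n" using small' by simp
  finally have "\<bar>N * \<pi> - real n * P\<bar> / real n < \<epsilon>" using \<open>n > 0\<close> by (simp add: divide_simps)
  also have "\<bar>N * \<pi> - real n * P\<bar> / real n = \<bar>(N * \<pi> - real n * P) / real n\<bar>" by simp
  also have "(N * \<pi> - real n * P) / real n = N / (real n * inverse \<pi>) - P"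
    using \<open>n > 0\<close> \<open>0 < \<pi>\<close> by (simp add: field_simps)
  finally show "\<bar>N / (real n * inverse \<pi>) - P\<bar> < \<epsilon>" .
qed

context galton_watson
begin

lemma length_word [simp]: "length (word m \<omega>) = m"
  by (simp add: word_def)

lemma marks_in_word: "real (length (filter (\<lambda>k. k \<in> \<Omega>) (word m \<omega>))) = (\<Sum>i<m. window (\<lambda>_. \<Omega>) 1 i \<omega>)"
  by (induction m) (simp_all add: word_def window_def)

text \<open>
  The windows continue past the end of the word, so up to \<open>length w\<close> of them may match without
  being occurrences.
\<close>

lemma occurrences_in_word:
  "\<bar>real (occurrences w (word m \<omega>)) - (\<Sum>i<m. window (\<lambda>k. {w ! k}) (length w) i \<omega>)\<bar> \<le> real (length w)"
proof -
  let ?W = "\<lambda>i. window (\<lambda>k. {w ! k}) (length w) i \<omega>"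
  let ?J = "{i \<in> {..<m}. m < i + length w}"
  have "take (length w) (drop i (word m \<omega>)) = w \<longleftrightarrow> i + length w \<le> m \<and> (\<forall>k<length w. X [i + k] \<omega> = w ! k)"
    if "i < m" for i
  proof -
    have nth: "word m \<omega> ! j = X [j] \<omega>" if "j < m" for j using that by (simp add: word_def)
    have "take (length w) (drop i (word m \<omega>)) = w \<longleftrightarrow>
        i + length w \<le> m \<and> (\<forall>k<length w. word m \<omega> ! (i + k) = w ! k)"
      using that by (auto simp: list_eq_iff_nth_eq min_def split: if_splits)
    then show ?thesis by (auto simp: nth)
  qed
  then have "?W i = (if take (length w) (drop i (word m \<omega>)) = w then 1 else 0) + (if i \<in> ?J then ?W i else 0)"
    if "i < m" for i
    using that by (auto simp: window_def)
  then have "(\<Sum>i<m. ?W i) = (\<Sum>i<m. (if take (length w) (drop i (word m \<omega>)) = w then 1 else 0)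
      + (if i \<in> ?J then ?W i else 0))"
    by (intro sum.cong) auto
  also have "\<dots> = real (occurrences w (word m \<omega>)) + (\<Sum>i<m. if i \<in> ?J then ?W i else 0)"
    by (simp add: sum.distrib occurrences_eq_sum if_distrib[of real] cong: if_cong)
  also have "(\<Sum>i<m. if i \<in> ?J then ?W i else 0) = (\<Sum>i\<in>?J. ?W i)"
    by (subst sum.inter_filter) (auto intro!: sum.cong)
  finally have "(\<Sum>i<m. ?W i) - real (occurrences w (word m \<omega>)) = (\<Sum>i\<in>?J. ?W i)" by simp
  moreover have "0 \<le> (\<Sum>i\<in>?J. ?W i)" by (intro sum_nonneg) (simp add: window_def)
  moreover have "(\<Sum>i\<in>?J. ?W i) \<le> real (card ?J) * 1"
    by (rule sum_bounded_above) (simp add: window_def)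
  moreover have "card ?J \<le> card {m - length w..<m}" by (intro card_mono) auto
  then have "real (card ?J) \<le> real (length w)" by simp
  ultimately show ?thesis by linarith
qed

lemma atypical_word_exponentially_unlikely:
  assumes "\<eta> > 0" "w \<noteq> []"
  shows "\<exists>C. \<exists>c>0. \<exists>m0. \<forall>m\<ge>m0. prob {\<omega> \<in> space M. atypical_word p \<Omega> w \<eta> (word m \<omega>)} \<le> C * exp (- c * real m)"
proof -
  let ?P = "prod_list (map (pmf p) w)" and ?\<pi> = "measure_pmf.prob p \<Omega>" and ?l = "length w"
  let ?D1 = "\<lambda>m. {\<omega> \<in> space M. \<bar>(\<Sum>i<m. window (\<lambda>_. \<Omega>) 1 i \<omega>) - real m * ?\<pi>\<bar> \<ge> \<eta> / 2 * real m + real 1}"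
  let ?D2 = "\<lambda>m. {\<omega> \<in> space M. \<bar>(\<Sum>i<m. window (\<lambda>k. {w ! k}) ?l i \<omega>) - real m * ?P\<bar> \<ge> \<eta> / 2 * real m + real ?l}"
  obtain C1 c1 where "c1 > 0" and 1: "\<And>m. prob (?D1 m) \<le> C1 * exp (- c1 * real m)"
    using window_concentration[of 1 "\<eta> / 2" ?\<pi> "\<lambda>_. \<Omega>"] assms by auto
  have "?P = (\<Prod>k<?l. measure_pmf.prob p {w ! k})"
    by (simp add: prod.list_conv_set_nth lessThan_atLeast0 measure_pmf_single)
  then obtain C2 c2 where "c2 > 0" and 2: "\<And>m. prob (?D2 m) \<le> C2 * exp (- c2 * real m)"
    using window_concentration[of ?l "\<eta> / 2" ?P "\<lambda>k. {w ! k}"] assms by auto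
  define c where "c = min c1 c2"
  have le: "C' * exp (- c' * real m) \<le> \<bar>C'\<bar> * exp (- c * real m)" if "c \<le> c'" for C' c' :: real and m
    using that by (intro mult_mono) (auto intro: mult_right_mono)
  have "prob {\<omega> \<in> space M. atypical_word p \<Omega> w \<eta> (word m \<omega>)} \<le> (\<bar>C1\<bar> + \<bar>C2\<bar>) * exp (- c * real m)"
    if m: "m \<ge> nat \<lceil>4 * real ?l / \<eta>\<rceil>" for m
  proof -
    have "4 * real ?l / \<eta> \<le> real m" using m by linarith
    then have large: "2 * real ?l \<le> \<eta> / 2 * real m" using \<open>\<eta> > 0\<close> by (simp add: field_simps)
    have l: "real ?l \<ge> 1" using assms(2) by (cases w) auto
    have "{\<omega> \<in> space M. atypical_word p \<Omega> w \<eta> (word m \<omega>)} \<subseteq> ?D1 m \<union> ?D2 m"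
    proof
      fix \<omega> assume "\<omega> \<in> {\<omega> \<in> space M. atypical_word p \<Omega> w \<eta> (word m \<omega>)}"
      then show "\<omega> \<in> ?D1 m \<union> ?D2 m"
        using large l occurrences_in_word[of w m \<omega>]
        unfolding atypical_word_def marks_in_word length_word by auto
    qed
    then have "prob {\<omega> \<in> space M. atypical_word p \<Omega> w \<eta> (word m \<omega>)} \<le> prob (?D1 m \<union> ?D2 m)"
      by (intro finite_measure_mono) auto
    also have "\<dots> \<le> prob (?D1 m) + prob (?D2 m)" by (intro measure_Un_le) auto
    also have "\<dots> \<le> \<bar>C1\<bar> * exp (- c * real m) + \<bar>C2\<bar> * exp (- c * real m)"
      by (intro add_mono order_trans[OF 1 le] order_trans[OF 2 le]) (auto simp: c_def)
    finally show ?thesis by (simp add: algebra_simps)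
  qed
  moreover have "c > 0" using \<open>c1 > 0\<close> \<open>c2 > 0\<close> by (simp add: c_def)
  ultimately show ?thesis by blast
qed

text \<open>
  Dividing the exponential bound for atypical trees by the subexponential lower bound for the
  condition. The events \<open>Q\<close> are arbitrary so that both conclusions of the theorem are instances, with
  the same rate.
\<close>

lemma conditional_prob_atypical_le:
  assumes "integrable (measure_pmf p) real" "measure_pmf.expectation p real < 1"
    and "pmf p 0 > 0" "measure_pmf.prob p \<Omega> > 0" "finite \<Omega> \<or> finite (- \<Omega>)"
    and subexp: "\<And>\<delta>. \<delta> > 0 \<Longrightarrow> \<forall>\<^sub>F d in sequentially. pmf p d \<ge> exp (- \<delta> * real d)"
    and "\<eta> > 0" "w \<noteq> []"
  shows "\<exists>c>0. \<forall>\<^sub>F n in sequentially.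
    0 < prob {\<omega> \<in> space M. outdegree_count \<Omega> (GW \<omega>) = n} \<and>
    (\<forall>Q. (\<forall>\<omega> t. GW \<omega> = verts t \<longrightarrow> Q \<omega> \<longrightarrow> outdegree_count \<Omega> (GW \<omega>) = n \<longrightarrow>
            atypical_word p \<Omega> w \<eta> (dfs_word t)) \<longrightarrow>
         \<P>(\<omega> in M. Q \<omega> \<bar> outdegree_count \<Omega> (GW \<omega>) = n) \<le> exp (- c * real n))"
proof -
  obtain C c m0 where "c > 0"
    and bad: "\<And>m. m \<ge> m0 \<Longrightarrow> prob {\<omega> \<in> space M. atypical_word p \<Omega> w \<eta> (word m \<omega>)} \<le> C * exp (- c * real m)"
    using atypical_word_exponentially_unlikely[OF assms(7,8)] by blast
  define K where "K = C / (1 - exp (- c))"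
  \<comment> \<open>Half of the rate \<open>c\<close> pays for the condition, a quarter absorbs the constant \<open>K\<close>.\<close>
  have "\<forall>\<^sub>F n in sequentially. exp (- (c / 2) * real n) \<le> prob {\<omega> \<in> space M. outdegree_count \<Omega> (GW \<omega>) = n}"
    by (rule prob_outdegree_count_subexponential[OF assms(1-6)]) (use \<open>c > 0\<close> in auto)
  moreover have "\<forall>\<^sub>F n in sequentially. (\<bar>K\<bar> + 1) * exp (- c * real n) \<le> exp (- (c / 4) * real n) * exp (- (c / 2) * real n)"
  proof -
    have "\<bar>K\<bar> + 1 > 0" by simp
    then show ?thesis using \<open>c > 0\<close> by real_asymp
  qed
  ultimately have "\<forall>\<^sub>F n in sequentially.
    0 < prob {\<omega> \<in> space M. outdegree_count \<Omega> (GW \<omega>) = n} \<and>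
    (\<forall>Q. (\<forall>\<omega> t. GW \<omega> = verts t \<longrightarrow> Q \<omega> \<longrightarrow> outdegree_count \<Omega> (GW \<omega>) = n \<longrightarrow>
            atypical_word p \<Omega> w \<eta> (dfs_word t)) \<longrightarrow>
         \<P>(\<omega> in M. Q \<omega> \<bar> outdegree_count \<Omega> (GW \<omega>) = n) \<le> exp (- (c / 4) * real n))"
    using eventually_ge_at_top[of m0]
  proof eventually_elim
    case (elim n)
    let ?E = "{\<omega> \<in> space M. outdegree_count \<Omega> (GW \<omega>) = n}"
    have pos: "0 < prob ?E" using elim(1) exp_gt_zero by (rule less_le_trans[rotated])
    moreover have "\<P>(\<omega> in M. Q \<omega> \<bar> outdegree_count \<Omega> (GW \<omega>) = n) \<le> exp (- (c / 4) * real n)"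
      if Q: "\<And>\<omega> t. GW \<omega> = verts t \<Longrightarrow> Q \<omega> \<Longrightarrow> outdegree_count \<Omega> (GW \<omega>) = n \<Longrightarrow>
            atypical_word p \<Omega> w \<eta> (dfs_word t)" for Q
    proof -
      have "prob {\<omega> \<in> space M. Q \<omega> \<and> outdegree_count \<Omega> (GW \<omega>) = n} \<le> K * exp (- c * real n)"
        unfolding K_def
      proof (rule prob_large_bad_tree_le[OF assms(1,2) \<open>c > 0\<close> bad])
        fix \<omega> t assume "\<omega> \<in> {\<omega> \<in> space M. Q \<omega> \<and> outdegree_count \<Omega> (GW \<omega>) = n}" and t: "GW \<omega> = verts t"
        then have "Q \<omega>" "outdegree_count \<Omega> (GW \<omega>) = n" by auto
        moreover from this have "n \<le> length (dfs_word t)"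
          unfolding t outdegree_count_verts by (metis length_filter_le)
        ultimately show "n \<le> length (dfs_word t) \<and> atypical_word p \<Omega> w \<eta> (dfs_word t)"
          using Q[OF t] by blast
      qed (use elim in auto)
      also have "\<dots> \<le> (\<bar>K\<bar> + 1) * exp (- c * real n)" by (intro mult_right_mono) auto
      also have "\<dots> \<le> exp (- (c / 4) * real n) * exp (- (c / 2) * real n)" by (rule elim)
      also have "\<dots> \<le> exp (- (c / 4) * real n) * prob ?E" using elim(1) by (intro mult_left_mono) auto
      finally show ?thesis using pos by (simp add: cond_prob_def pos_divide_le_eq)
    qed
    ultimately show ?case by blast
  qed
  then show ?thesis using \<open>c > 0\<close> by (intro exI[of _ "c / 4"]) auto
qed

end

theorem lemma1p8:
  fixes M :: "'w measure"
    and X :: "vertex \<Rightarrow> 'w \<Rightarrow> nat"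
    and p :: "nat pmf"
    and f :: "real \<Rightarrow> real"
    and \<alpha> \<epsilon> :: real
    and \<Omega> :: "nat set"
    and T :: "vertex set"
  assumes "pmf p 0 > 0"
    and "measure_pmf.prob p {..1} < 1"
    and "integrable (measure_pmf p) real"
    and "measure_pmf.expectation p real < 1"
    and "slowly_varying f"
    and "\<alpha> > 1"
    and "\<forall>\<^sub>F n in sequentially. pmf p n = f (real n) * real n powr (- 1 - \<alpha>)"
    and "\<Omega> \<noteq> {}"
    and "measure_pmf.prob p \<Omega> > 0"
    and "finite \<Omega> \<or> finite (- \<Omega>)"
    and "prob_space M"
    and "iid_offspring M p X"
    and "plane_tree T"
    and "finite T"
    and "\<epsilon> > 0"
  shows "\<exists>c>0. \<exists>n\<^sub>0::nat. \<forall>n\<ge>n\<^sub>0.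
    \<P>(\<omega> in M. outdegree_count \<Omega> (galton_watson_tree X \<omega>) = n) > 0 \<and>
    \<P>(\<omega> in M.
        \<bar>real (fringe_count T (galton_watson_tree X \<omega>)) / (real n * inverse (measure_pmf.prob p \<Omega>))
           - \<P>(\<omega>' in M. galton_watson_tree X \<omega>' = T)\<bar> \<ge> \<epsilon>
        \<bar> outdegree_count \<Omega> (galton_watson_tree X \<omega>) = n) \<le> exp (- c * real n) \<and>
    \<P>(\<omega> in M.
        \<bar>real (card (galton_watson_tree X \<omega>)) - real n * inverse (measure_pmf.prob p \<Omega>)\<bar>
           \<ge> \<epsilon> * real n
        \<bar> outdegree_count \<Omega> (galton_watson_tree X \<omega>) = n) \<le> exp (- c * real n)"
proof -
  interpret prob_space M by fact
  interpret galton_watson M p X by unfold_locales fact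
  obtain \<tau> where \<tau>: "verts \<tau> = T"
    using finite_plane_tree_is_verts assms by blast
  let ?w = "dfs_word \<tau>"
  define \<pi> P \<eta> where "\<pi> = measure_pmf.prob p \<Omega>" and "P = prod_list (map (pmf p) ?w)"
    and "\<eta> = min (\<pi> / 2) (\<epsilon> * \<pi>\<^sup>2 / 4)"
  have \<pi>: "0 < \<pi>" "\<pi> \<le> 1" using assms by (auto simp: \<pi>_def)
  have prob_T: "prob {\<omega> \<in> space M. GW \<omega> = T} = P"
    using prob_GW_eq_verts[of \<tau>] by (simp add: \<tau> P_def weight_def)
  have P: "0 \<le> P" "P \<le> 1"
    using weight_nonneg[of p \<tau>] weight_le_1[of \<tau>] by (simp_all add: P_def weight_def)
  have \<eta>: "0 < \<eta>" "\<eta> \<le> \<pi> / 2" "\<eta> \<le> \<epsilon> * \<pi>\<^sup>2 / 4"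
    using \<pi> assms(15) by (auto simp: \<eta>_def)
  have "?w \<noteq> []" by (cases \<tau>) (simp add: dfs_word_Node)
  have subexp: "\<forall>\<^sub>F d in sequentially. pmf p d \<ge> exp (- \<delta> * real d)" if "\<delta> > 0" for \<delta>
    using regularly_varying_pmf_subexponential[OF assms(5,7) that] .
  obtain c where "c > 0" and c: "\<forall>\<^sub>F n in sequentially.
    0 < prob {\<omega> \<in> space M. outdegree_count \<Omega> (GW \<omega>) = n} \<and>
    (\<forall>Q. (\<forall>\<omega> t. GW \<omega> = verts t \<longrightarrow> Q \<omega> \<longrightarrow> outdegree_count \<Omega> (GW \<omega>) = n \<longrightarrow>
            atypical_word p \<Omega> ?w \<eta> (dfs_word t)) \<longrightarrow>
         \<P>(\<omega> in M. Q \<omega> \<bar> outdegree_count \<Omega> (GW \<omega>) = n) \<le> exp (- c * real n))"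
    using conditional_prob_atypical_le[OF assms(3,4,1,9,10) subexp \<eta>(1) \<open>?w \<noteq> []\<close>] by blast
  have typical: "\<bar>real (fringe_count T (GW \<omega>)) / (real n * inverse \<pi>) - P\<bar> < \<epsilon>"
      "\<bar>real (card (GW \<omega>)) - real n * inverse \<pi>\<bar> < \<epsilon> * real n"
    if "n > 0" "GW \<omega> = verts t" "outdegree_count \<Omega> (GW \<omega>) = n" "\<not> atypical_word p \<Omega> ?w \<eta> (dfs_word t)"
    for n \<omega> t
    using that typical_word_ratios[OF \<open>n > 0\<close> \<pi> P assms(15) _ \<eta>, of "real (length (dfs_word t))"
        "real (occurrences ?w (dfs_word t))"]
    by (simp_all add: atypical_word_def not_le outdegree_count_verts fringe_count_verts card_verts
        \<tau>[symmetric] \<pi>_def[symmetric] P_def[symmetric])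
  have "\<forall>\<^sub>F n in sequentially.
    \<P>(\<omega> in M. outdegree_count \<Omega> (GW \<omega>) = n) > 0 \<and>
    \<P>(\<omega> in M. \<bar>real (fringe_count T (GW \<omega>)) / (real n * inverse \<pi>) - P\<bar> \<ge> \<epsilon>
        \<bar> outdegree_count \<Omega> (GW \<omega>) = n) \<le> exp (- c * real n) \<and>
    \<P>(\<omega> in M. \<bar>real (card (GW \<omega>)) - real n * inverse \<pi>\<bar> \<ge> \<epsilon> * real n
        \<bar> outdegree_count \<Omega> (GW \<omega>) = n) \<le> exp (- c * real n)"
    using c eventually_gt_at_top[of 0]
  proof eventually_elim
    case (elim n)
    have bound: "\<P>(\<omega> in M. Q \<omega> \<bar> outdegree_count \<Omega> (GW \<omega>) = n) \<le> exp (- c * real n)"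
      if "\<And>\<omega> t. GW \<omega> = verts t \<Longrightarrow> Q \<omega> \<Longrightarrow> outdegree_count \<Omega> (GW \<omega>) = n \<Longrightarrow>
            atypical_word p \<Omega> ?w \<eta> (dfs_word t)" for Q
      using elim(1) that by blast
    show ?case
    proof (intro conjI bound)
      fix \<omega> t assume t: "GW \<omega> = verts t" "outdegree_count \<Omega> (GW \<omega>) = n"
      assume "\<bar>real (fringe_count T (GW \<omega>)) / (real n * inverse \<pi>) - P\<bar> \<ge> \<epsilon>"
      then show "atypical_word p \<Omega> ?w \<eta> (dfs_word t)" using typical(1)[OF elim(2) t] by linarith
    next
      fix \<omega> t assume t: "GW \<omega> = verts t" "outdegree_count \<Omega> (GW \<omega>) = n"
      assume "\<bar>real (card (GW \<omega>)) - real n * inverse \<pi>\<bar> \<ge> \<epsilon> * real n"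
      then show "atypical_word p \<Omega> ?w \<eta> (dfs_word t)" using typical(2)[OF elim(2) t] by linarith
    qed (use elim(1) in simp)
  qed
  then show ?thesis
    unfolding eventually_sequentially prob_T \<pi>_def[symmetric]
    using \<open>c > 0\<close> by (intro exI[of _ c] conjI) simp_all
qed

end
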